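(* Let $1\le p<\infty$, $n\in\mathbb N$, $F\in L^p$, and $f=F^{(n)}\in L^{(n),p}$. Let $\Phi_y(x)=\frac{y}{\pi}(x^2+y^2)^{-1}$ and $U_y(x)=\Phi_y\ast F(x)=\frac{y}{\pi}\int_{-\infty}^\infty F(\xi)[(x-\xi)^2+y^2]^{-1}\,d\xi$ for $(x,y)\in\Pi^+=\{(x,y): y>0\}$. Then: (a) for each $(x,y)\in\Pi^+$, the Poisson integral $u_y(x)=\Phi_y\ast f(x):=(-1)^n\int_{-\infty}^\infty F(\xi)\,\frac{\partial^n}{\partial\xi^n}\Phi_y(\xi-x)\,d\xi$ is well defined (as a Lebesgue integral) and equals $\frac{\partial^n}{\partial x^n}U_y(x)$; (b) $(x,y)\mapsto u_y(x)$ is harmonic in $\Pi^+$; (c) for each $y>0$, $u_y\in L^{(n),p}$ (with primitive $U_y$) and $\|u_y\|^{(n)}_p\le\|f\|^{(n)}_p$; (d) $\|u_y-f\|^{(n)}_p\to0$ as $y\to0^+$.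
   Context: $D^n$ or $F^{(n)}$ denotes the $n$th distributional derivative on $\mathcal S'$. For $1\le p<\infty$, $L^{(n),p}=\{f\in\mathcal S' : f=D^nF \text{ for some } F\in L^p(\mathbb R)\}$; such $F$ is unique (the primitive), linear operations are defined through primitives, and $\|f\|^{(n)}_p:=\|F\|_p$. *)

theory Defs
  imports "HOL-Analysis.Analysis"
begin

definition Lp :: "real \<Rightarrow> (real \<Rightarrow> real) \<Rightarrow> bool" where
  "Lp p g \<longleftrightarrow> g \<in> borel_measurable lborel \<and> integrable lborel (\<lambda>x. \<bar>g x\<bar> powr p)"

definition Lp_norm :: "real \<Rightarrow> (real \<Rightarrow> real) \<Rightarrow> real" where
  "Lp_norm p g = (LINT x|lborel. \<bar>g x\<bar> powr p) powr (1 / p)"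

definition schwartz :: "(real \<Rightarrow> real) \<Rightarrow> bool" where
  "schwartz \<phi> \<longleftrightarrow>
     (\<forall>m x. ((deriv ^^ m) \<phi> has_real_derivative (deriv ^^ Suc m) \<phi> x) (at x)) \<and>
     (\<forall>k m. \<exists>C. \<forall>x. \<bar>x\<bar> ^ k * \<bar>(deriv ^^ m) \<phi> x\<bar> \<le> C)"

definition is_nth_distr_deriv :: "nat \<Rightarrow> (real \<Rightarrow> real) \<Rightarrow> (real \<Rightarrow> real) \<Rightarrow> bool" where
  "is_nth_distr_deriv n G g \<longleftrightarrow>
     (\<forall>\<phi>. schwartz \<phi> \<longrightarrow>
        integrable lborel (\<lambda>x. g x * \<phi> x) \<and>
        (LINT x|lborel. g x * \<phi> x) = (-1) ^ n * (LINT x|lborel. G x * (deriv ^^ n) \<phi> x))"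

definition has_nth_derivs :: "nat \<Rightarrow> (real \<Rightarrow> real) \<Rightarrow> bool" where
  "has_nth_derivs n g \<longleftrightarrow>
     (\<forall>k<n. \<forall>x. ((deriv ^^ k) g has_real_derivative (deriv ^^ Suc k) g x) (at x))"

definition harmonic_on :: "(real \<times> real) set \<Rightarrow> (real \<times> real \<Rightarrow> real) \<Rightarrow> bool" where
  "harmonic_on S g \<longleftrightarrow> open S \<and>
    (\<exists>gx gy gxx gxy gyx gyy.
      (\<forall>a b. (a, b) \<in> S \<longrightarrow>
         ((\<lambda>t. g (t, b)) has_real_derivative gx (a, b)) (at a) \<and>
         ((\<lambda>t. g (a, t)) has_real_derivative gy (a, b)) (at b) \<and>
         ((\<lambda>t. gx (t, b)) has_real_derivative gxx (a, b)) (at a) \<and>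
         ((\<lambda>t. gx (a, t)) has_real_derivative gxy (a, b)) (at b) \<and>
         ((\<lambda>t. gy (t, b)) has_real_derivative gyx (a, b)) (at a) \<and>
         ((\<lambda>t. gy (a, t)) has_real_derivative gyy (a, b)) (at b) \<and>
         gxx (a, b) + gyy (a, b) = 0) \<and>
      continuous_on S g \<and> continuous_on S gx \<and> continuous_on S gy \<and>
      continuous_on S gxx \<and> continuous_on S gxy \<and> continuous_on S gyx \<and>
      continuous_on S gyy)"

definition poisson_kernel :: "real \<Rightarrow> real \<Rightarrow> real" where
  "poisson_kernel y x = y / (pi * (x ^ 2 + y ^ 2))"

definition poisson_U :: "(real \<Rightarrow> real) \<Rightarrow> real \<Rightarrow> real \<Rightarrow> real" where
  "poisson_U F y x = (LINT \<xi>|lborel. F \<xi> * poisson_kernel y (x - \<xi>))"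

definition poisson_u :: "nat \<Rightarrow> (real \<Rightarrow> real) \<Rightarrow> real \<Rightarrow> real \<Rightarrow> real" where
  "poisson_u n F y x =
     (-1) ^ n * (LINT \<xi>|lborel. F \<xi> * (deriv ^^ n) (\<lambda>\<eta>. poisson_kernel y (\<eta> - x)) \<xi>)"

end

theory Submission
  imports Defs "HOL-Probability.Probability_Measure"
begin

text \<open>
  The Poisson kernel is \<open>Im (1 / (\<pi> (\<xi> - z)))\<close> with \<open>z = x + iy\<close>, so \<open>u\<^sub>y(x)\<close> is the imaginary part of
  the \<open>n\<close>-th derivative of the (regularised) Cauchy transform of \<open>F\<close>, which is holomorphic in the upper
  half plane as soon as \<open>F(\<xi>) / (1 + \<xi>\<^sup>2)\<close> is integrable. The derivative formula and harmonicity are then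
  the Cauchy-Riemann equations. Since \<open>u\<^sub>y\<close> grows at most quadratically, integration by parts against
  Schwartz functions identifies it with the distributional derivative of \<open>U\<^sub>y\<close>. Jensen's inequality for
  the probability density \<open>\<Phi>\<^sub>y\<close> and Tonelli's theorem bound the \<open>p\<close>-th power integral of \<open>U\<^sub>y - F\<close> by the
  \<open>\<Phi>\<^sub>y\<close>-average over \<open>t\<close> of that of \<open>F(\<cdot> - t) - F\<close>, which tends to zero because translation is
  continuous in \<open>L\<^sup>p\<close>.
\<close>

subsection \<open>The Cauchy transform\<close>

text \<open>Differentiation under the integral sign. The mean value inequality on the convex ball
  turns the bound \<open>g\<close> for the derivative into a bound for the difference quotients, so
  dominated convergence applies along every sequence tending to \<open>z\<close>.\<close>

lemma has_field_derivative_integral: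
  fixes f f' :: "complex \<Rightarrow> 'b \<Rightarrow> complex"
  assumes r: "0 < r"
    and df: "\<And>w x. w \<in> ball z r \<Longrightarrow> x \<in> space M \<Longrightarrow> ((\<lambda>w. f w x) has_field_derivative f' w x) (at w)"
    and bd: "\<And>w x. w \<in> ball z r \<Longrightarrow> x \<in> space M \<Longrightarrow> norm (f' w x) \<le> g x"
    and g: "integrable M g"
    and f: "\<And>w. w \<in> ball z r \<Longrightarrow> integrable M (f w)"
    and f': "f' z \<in> borel_measurable M"
  shows "((\<lambda>w. LINT x|M. f w x) has_field_derivative (LINT x|M. f' z x)) (at z)"
proof -
  have z: "z \<in> ball z r" using r by simp
  \<comment> \<open>Approaching within the ball keeps the sequence where the hypotheses hold; as the
    ball is open, this is the full limit at \<open>z\<close>.\<close>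
  have "((\<lambda>w. ((LINT x|M. f w x) - (LINT x|M. f z x)) / (w - z)) \<longlongrightarrow> (LINT x|M. f' z x)) (at z within ball z r)"
    unfolding tendsto_at_iff_sequentially
  proof (intro allI impI)
    fix X :: "nat \<Rightarrow> complex"
    assume X: "\<forall>i. X i \<in> ball z r - {z}" and Xz: "X \<longlonglongrightarrow> z"
    have "(\<lambda>i. LINT x|M. (f (X i) x - f z x) / (X i - z)) \<longlonglongrightarrow> (LINT x|M. f' z x)"
    proof (rule integral_dominated_convergence)
      show "f' z \<in> borel_measurable M" by (rule f')
      show "(\<lambda>x. (f (X i) x - f z x) / (X i - z)) \<in> borel_measurable M" for i
        using f[of "X i"] f[OF z] X by (auto intro!: borel_measurable_integrable)
      show "integrable M g" by (rule g)
      show "AE x in M. (\<lambda>i. (f (X i) x - f z x) / (X i - z)) \<longlonglongrightarrow> f' z x"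
      proof (rule AE_I2)
        fix x assume x: "x \<in> space M"
        have "((\<lambda>w. (f w x - f z x) / (w - z)) \<longlongrightarrow> f' z x) (at z)"
          using df[OF z x] by (simp add: has_field_derivative_iff)
        moreover have "filterlim X (at z) sequentially"
          using X Xz by (auto simp: filterlim_at)
        ultimately show "(\<lambda>i. (f (X i) x - f z x) / (X i - z)) \<longlonglongrightarrow> f' z x"
          by (rule filterlim_compose)
      qed
      show "AE x in M. norm ((f (X i) x - f z x) / (X i - z)) \<le> g x" for i
      proof (rule AE_I2)
        fix x assume x: "x \<in> space M"
        have "norm (f (X i) x - f z x) \<le> g x * norm (X i - z)"
          by (rule field_differentiable_bound[of "ball z r" _ "\<lambda>w. f' w x"])
            (use X z df[OF _ x] bd[OF _ x] in \<open>auto intro: has_field_derivative_at_within\<close>)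
        then show "norm ((f (X i) x - f z x) / (X i - z)) \<le> g x"
          using X by (auto simp: norm_divide divide_le_eq)
      qed
    qed
    moreover have "(LINT x|M. (f (X i) x - f z x) / (X i - z)) =
        ((LINT x|M. f (X i) x) - (LINT x|M. f z x)) / (X i - z)" for i
      using f[of "X i"] f[OF z] X by simp
    ultimately show "((\<lambda>w. ((LINT x|M. f w x) - (LINT x|M. f z x)) / (w - z)) \<circ> X)
        \<longlonglongrightarrow> (LINT x|M. f' z x)"
      by (simp only: comp_def)
  qed
  then show ?thesis
    using z by (simp add: has_field_derivative_iff at_within_open[OF z])
qed

text \<open>
  The \<open>n\<close>-th \<open>z\<close>-derivative of \<open>1 / (\<pi> (\<xi> - z))\<close>. For \<open>n = 0\<close> a real term is subtracted: it does not
  change the imaginary part and improves the decay in \<open>\<xi>\<close> to \<open>\<xi>\<close> to the power \<open>-2\<close>, so that the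
  integral against \<open>F\<close> converges absolutely for every \<open>p\<close>.
\<close>

definition cauchy_kernel :: "nat \<Rightarrow> complex \<Rightarrow> real \<Rightarrow> complex" where
  "cauchy_kernel n z \<xi> = of_real (fact n / pi) / (of_real \<xi> - z) ^ Suc n
     - (if n = 0 then of_real (\<xi> / (pi * (1 + \<xi>\<^sup>2))) else 0)"

text \<open>The factor \<open>fact n\<close> absorbs the constant produced by each differentiation,
  and the term subtracted for \<open>n = 0\<close> does not depend on \<open>z\<close>, so the
  family is closed under differentiation.\<close>

lemma DERIV_cauchy_kernel:
  assumes "Im z > 0"
  shows "((\<lambda>w. cauchy_kernel n w \<xi>) has_field_derivative cauchy_kernel (Suc n) z \<xi>) (at z)"
proof -
  have nz: "of_real \<xi> - z \<noteq> 0"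
    using assms by (auto simp: complex_eq_iff)
  have "((\<lambda>w. of_real (fact n / pi) / (of_real \<xi> - w) ^ Suc n) has_field_derivative
      of_real (fact (Suc n) / pi) / (of_real \<xi> - z) ^ Suc (Suc n)) (at z)"
  proof -
    have "((\<lambda>w. (of_real \<xi> - w) ^ Suc n) has_field_derivative
        of_nat (Suc n) * (- 1 * (of_real \<xi> - z) ^ (Suc n - Suc 0))) (at z)"
      by (rule DERIV_power) (auto intro!: derivative_eq_intros)
    from DERIV_divide[OF DERIV_const[of "of_real (fact n / pi)"] this]
    show ?thesis
    proof (rule DERIV_cong)
      have "(0 * w ^ Suc n - of_real (fact n / pi) * (of_nat (Suc n) * (- 1 * w ^ (Suc n - Suc 0)))) /
          (w ^ Suc n * w ^ Suc n) = of_real (fact (Suc n) / pi) / w ^ Suc (Suc n)"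
        if "w \<noteq> 0" for w :: complex
        using that by (simp add: field_simps)
      from this[OF nz] show "(0 * (of_real \<xi> - z) ^ Suc n - of_real (fact n / pi) *
          (of_nat (Suc n) * (- 1 * (of_real \<xi> - z) ^ (Suc n - Suc 0)))) /
          ((of_real \<xi> - z) ^ Suc n * (of_real \<xi> - z) ^ Suc n) =
          of_real (fact (Suc n) / pi) / (of_real \<xi> - z) ^ Suc (Suc n)" .
    qed (use nz in simp)
  qed
  from DERIV_diff[OF this DERIV_const] show ?thesis
    unfolding cauchy_kernel_def by simp
qed

lemma cauchy_kernel_measurable [measurable]: "cauchy_kernel n z \<in> borel_measurable borel"
  unfolding cauchy_kernel_def by measurable

section \<open>Decay of the kernels in the node, with explicit constants\<close>

text \<open>With \<open>d\<close> the distance from \<open>\<xi>\<close> to \<open>z\<close>, the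
  triangle inequality bounds the square of \<open>\<xi>\<close> by
  \<open>2 * d^2 + 2 * (norm z)^2\<close>; the remaining constants are absorbed by means of
  \<open>d \<ge> Im z\<close>.\<close>

lemma one_plus_square_le_dist:
  assumes "Im z > 0"
  shows "1 + \<xi>\<^sup>2 \<le> (2 + (1 + 2 * (norm z)\<^sup>2) / (Im z)\<^sup>2) * (norm (of_real \<xi> - z))\<^sup>2"
proof -
  define d where "d = norm (of_real \<xi> - z)"
  have d: "Im z \<le> d" using abs_Im_le_cmod[of "of_real \<xi> - z"] by (simp add: d_def)
  have "1 \<le> d\<^sup>2 / (Im z)\<^sup>2"
    using d assms by (simp add: power_mono)
  then have "(1 + 2 * (norm z)\<^sup>2) * 1 \<le> (1 + 2 * (norm z)\<^sup>2) * (d\<^sup>2 / (Im z)\<^sup>2)"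
    by (intro mult_left_mono) auto
  moreover have "\<xi>\<^sup>2 \<le> 2 * d\<^sup>2 + 2 * (norm z)\<^sup>2"
  proof -
    have "\<bar>\<xi>\<bar> \<le> d + norm z"
      using norm_triangle_ineq[of "of_real \<xi> - z" z] by (simp add: d_def)
    then have "\<xi>\<^sup>2 \<le> (d + norm z)\<^sup>2"
      by (metis abs_ge_zero power2_abs power_mono)
    also have "\<dots> \<le> 2 * d\<^sup>2 + 2 * (norm z)\<^sup>2"
      using sum_squares_bound[of d "norm z"] by (simp add: power2_sum)
    finally show ?thesis .
  qed
  ultimately show ?thesis
    unfolding d_def[symmetric] by (simp add: algebra_simps)
qed

text \<open>Here \<open>b\<close> stands for a lower bound of \<open>Im z\<close> and
  \<open>R\<close> for an upper bound of \<open>norm z\<close>. Of the \<open>n + 1\<close> distance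
  factors in the denominator of the kernel, two provide the decay in \<open>\<xi>\<close> and the
  other \<open>n - 1\<close> are bounded below by \<open>b\<close>. It is applied only with
  \<open>n > 0\<close>.\<close>

definition kernel_const :: "nat \<Rightarrow> real \<Rightarrow> real \<Rightarrow> real" where
  "kernel_const n b R = fact n / pi / b ^ (n - 1) * (2 + (1 + 2 * R\<^sup>2) / b\<^sup>2)"

text \<open>Two distance factors give the decay, the other \<open>n - 2\<close> are at least
  \<open>b\<close>. The constant depends on \<open>z\<close> only through \<open>b\<close> and
  \<open>R\<close>, which makes it usable as a dominating function when \<open>z\<close>
  varies.\<close>

lemma inverse_dist_power_bound:
  assumes b: "0 < b" "b \<le> Im z" and R: "norm z \<le> R" and n: "2 \<le> n"
  shows "1 / norm (of_real \<xi> - z) ^ n \<le> (2 + (1 + 2 * R\<^sup>2) / b\<^sup>2) / b ^ (n - 2) / (1 + \<xi>\<^sup>2)"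
proof -
  define d where "d = norm (of_real \<xi> - z)"
  have d: "b \<le> d" using abs_Im_le_cmod[of "of_real \<xi> - z"] b by (simp add: d_def)
  then have d0: "d > 0" using b by simp
  have pos: "1 + \<xi>\<^sup>2 > 0" by (simp add: add_pos_nonneg)
  have "1 + \<xi>\<^sup>2 \<le> (2 + (1 + 2 * (norm z)\<^sup>2) / (Im z)\<^sup>2) * d\<^sup>2"
    unfolding d_def using one_plus_square_le_dist[of z \<xi>] b by simp
  also have "\<dots> \<le> (2 + (1 + 2 * R\<^sup>2) / b\<^sup>2) * d\<^sup>2"
    using b R by (intro mult_right_mono add_left_mono frac_le add_mono mult_left_mono power_mono) auto
  finally have 1: "1 / d\<^sup>2 \<le> (2 + (1 + 2 * R\<^sup>2) / b\<^sup>2) / (1 + \<xi>\<^sup>2)"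
    using d0 pos by (simp add: divide_simps mult.commute)
  have "d ^ n = d\<^sup>2 * d ^ (n - 2)"
    using power_add[of d 2 "n - 2"] by (simp only: le_add_diff_inverse[OF n])
  then have "1 / d ^ n = 1 / d\<^sup>2 * (1 / d ^ (n - 2))"
    by simp
  also have "\<dots> \<le> (2 + (1 + 2 * R\<^sup>2) / b\<^sup>2) / (1 + \<xi>\<^sup>2) * (1 / b ^ (n - 2))"
    using d b d0 pos by (intro mult_mono 1 frac_le power_mono) auto
  finally show ?thesis unfolding d_def by (simp add: mult_ac)
qed

lemma cauchy_kernel_Suc_bound:
  assumes b: "0 < b" "b \<le> Im z" and R: "norm z \<le> R"
  shows "norm (cauchy_kernel (Suc n) z \<xi>) \<le> kernel_const (Suc n) b R / (1 + \<xi>\<^sup>2)"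
proof -
  have "norm (cauchy_kernel (Suc n) z \<xi>) = fact (Suc n) / pi * (1 / norm (of_real \<xi> - z) ^ Suc (Suc n))"
    unfolding cauchy_kernel_def
    by (simp add: norm_divide norm_power norm_mult del: of_real_divide of_real_fact fact_Suc power_Suc)
  also have "\<dots> \<le> fact (Suc n) / pi * ((2 + (1 + 2 * R\<^sup>2) / b\<^sup>2) / b ^ (Suc (Suc n) - 2) / (1 + \<xi>\<^sup>2))"
    by (intro mult_left_mono inverse_dist_power_bound assms) auto
  also have "\<dots> = kernel_const (Suc n) b R / (1 + \<xi>\<^sup>2)"
    unfolding kernel_const_def by simp
  finally show ?thesis .
qed

lemma Im_cauchy_kernel_0:
  "Im (cauchy_kernel 0 z \<xi>) = Im z / (pi * ((\<xi> - Re z)\<^sup>2 + (Im z)\<^sup>2))"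
  unfolding cauchy_kernel_def by (simp add: Im_divide power_mult_distrib power2_eq_square[of pi] flip: distrib_left)

text \<open>Separates the quadratic growth in \<open>x\<close> from the decay in
  \<open>\<xi>\<close>, so that integrating against \<open>F\<close> leaves a quadratic bound for
  the Poisson integral. For \<open>n = 0\<close> the explicit imaginary part is estimated, for
  \<open>n > 0\<close> the modulus suffices.\<close>

lemma abs_Im_cauchy_kernel_bound:
  assumes y: "0 < y"
  shows "\<exists>C\<ge>0. \<forall>x \<xi>. \<bar>Im (cauchy_kernel n (Complex x y) \<xi>)\<bar> \<le> C * (1 + x\<^sup>2) / (1 + \<xi>\<^sup>2)"
proof -
  \<comment> \<open>The factor \<open>y / y ^ n\<close> treats both cases at once: it is
    \<open>y\<close> for \<open>n = 0\<close> and \<open>1 / y ^ (n - 1)\<close> otherwise.\<close>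
  have 1: "\<bar>Im (cauchy_kernel n (Complex x y) \<xi>)\<bar> \<le>
      fact n / pi * (2 + (1 + 2 * (norm (Complex x y))\<^sup>2) / y\<^sup>2) * (y / y ^ n) / (1 + \<xi>\<^sup>2)" for x \<xi>
  proof (cases n)
    case 0
    let ?z = "Complex x y"
    have "(\<xi> - x)\<^sup>2 + y\<^sup>2 = (norm (of_real \<xi> - ?z))\<^sup>2"
      by (simp add: cmod_power2)
    then have "\<bar>Im (cauchy_kernel n ?z \<xi>)\<bar> = y / pi * (1 / norm (of_real \<xi> - ?z) ^ 2)"
      using y by (simp add: 0 Im_cauchy_kernel_0)
    also have "\<dots> \<le> y / pi * ((2 + (1 + 2 * (norm ?z)\<^sup>2) / y\<^sup>2) / y ^ (2 - 2) / (1 + \<xi>\<^sup>2))"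
      using y by (intro mult_left_mono inverse_dist_power_bound) auto
    finally show ?thesis by (simp add: 0 mult_ac)
  next
    case (Suc m)
    have "\<bar>Im (cauchy_kernel n (Complex x y) \<xi>)\<bar> \<le> norm (cauchy_kernel n (Complex x y) \<xi>)"
      by (rule abs_Im_le_cmod)
    also have "\<dots> \<le> kernel_const n y (norm (Complex x y)) / (1 + \<xi>\<^sup>2)"
      unfolding Suc by (rule cauchy_kernel_Suc_bound) (use y in auto)
    also have "\<dots> = fact n / pi * (2 + (1 + 2 * (norm (Complex x y))\<^sup>2) / y\<^sup>2) * (y / y ^ n) / (1 + \<xi>\<^sup>2)"
      using y by (simp add: kernel_const_def Suc)
    finally show ?thesis .
  qed
  \<comment> \<open>Expanding the square of the norm as \<open>x^2 + y^2\<close> leaves a constant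
    term and a multiple of \<open>x^2\<close>; \<open>D\<close> is the sum of both coefficients and
    so dominates each.\<close>
  define D where "D = 2 + (1 + 2 * y\<^sup>2) / y\<^sup>2 + 2 / y\<^sup>2"
  define C where "C = fact n / pi * D * (y / y ^ n)"
  have D: "D \<ge> 0" unfolding D_def by simp
  have "2 + (1 + 2 * (norm (Complex x y))\<^sup>2) / y\<^sup>2 \<le> D * (1 + x\<^sup>2)" for x
  proof -
    have "2 + (1 + 2 * (norm (Complex x y))\<^sup>2) / y\<^sup>2 = 2 + (1 + 2 * y\<^sup>2) / y\<^sup>2 + 2 / y\<^sup>2 * x\<^sup>2"
      using y by (simp add: cmod_power2 field_simps)
    also have "\<dots> \<le> D + D * x\<^sup>2"
    proof (rule add_mono)
      show "2 / y\<^sup>2 * x\<^sup>2 \<le> D * x\<^sup>2"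
        by (rule mult_right_mono) (simp_all add: D_def)
    qed (simp add: D_def)
    finally show ?thesis by (simp add: distrib_left)
  qed
  then have "fact n / pi * (2 + (1 + 2 * (norm (Complex x y))\<^sup>2) / y\<^sup>2) * (y / y ^ n) / (1 + \<xi>\<^sup>2)
      \<le> fact n / pi * (D * (1 + x\<^sup>2)) * (y / y ^ n) / (1 + \<xi>\<^sup>2)" for x \<xi>
    using y by (intro divide_right_mono mult_right_mono mult_left_mono) auto
  then have "\<bar>Im (cauchy_kernel n (Complex x y) \<xi>)\<bar> \<le> C * (1 + x\<^sup>2) / (1 + \<xi>\<^sup>2)" for x \<xi>
    using order_trans[OF 1[of x \<xi>]] unfolding C_def by (simp add: mult_ac)
  moreover have "C \<ge> 0" using D y by (simp add: C_def)
  ultimately show ?thesis by blast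
qed

lemma cauchy_kernel_bound:
  assumes "Im z > 0"
  shows "\<exists>C. \<forall>\<xi>. norm (cauchy_kernel n z \<xi>) \<le> C / (1 + \<xi>\<^sup>2)"
proof (cases n)
  case 0
  have "norm (cauchy_kernel n z \<xi>) \<le> (norm (1 + z\<^sup>2) / Im z + norm z) / pi / (1 + \<xi>\<^sup>2)" for \<xi>
  proof -
    define w where "w = of_real \<xi> - z"
    have nz: "w \<noteq> 0" using assms by (auto simp: complex_eq_iff w_def)
    have w: "Im z \<le> norm w" using abs_Im_le_cmod[of w] by (simp add: w_def)
    have pos: "1 + \<xi>\<^sup>2 > 0" by (simp add: add_pos_nonneg)
    have nz2: "1 + (of_real \<xi>)\<^sup>2 \<noteq> (0::complex)"
      using pos by (metis of_real_1 of_real_add of_real_eq_0_iff of_real_power order_less_irrefl)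
    have "cauchy_kernel n z \<xi> = 1 / of_real pi / w - of_real \<xi> / (of_real pi * (1 + (of_real \<xi>)\<^sup>2))"
      unfolding cauchy_kernel_def 0 w_def by simp
    also have "\<dots> = ((1 + (of_real \<xi>)\<^sup>2 - of_real \<xi> * w) / w) / of_real pi / (1 + (of_real \<xi>)\<^sup>2)"
      using nz nz2 by (simp add: divide_simps)
    \<comment> \<open>The regularisation cancels the leading term: since
      \<open>\<xi> = w + z\<close>, the numerator is \<open>1 + \<xi> * z = 1 + z^2 + z * w\<close>,
      and its quotient by \<open>w\<close> stays bounded in \<open>\<xi>\<close>.\<close>
    also have "(1 + (of_real \<xi>)\<^sup>2 - of_real \<xi> * w) / w = (1 + z\<^sup>2) / w + z"
      using nz by (simp add: divide_simps) (simp add: w_def algebra_simps power2_eq_square)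
    finally have "norm (cauchy_kernel n z \<xi>) = norm ((1 + z\<^sup>2) / w + z) / pi / (1 + \<xi>\<^sup>2)"
      using norm_of_real[of "1 + \<xi>\<^sup>2", where 'a = complex] pos by (simp add: norm_divide norm_mult)
    also have "\<dots> \<le> (norm (1 + z\<^sup>2) / Im z + norm z) / pi / (1 + \<xi>\<^sup>2)"
    proof (intro divide_right_mono)
      have "norm ((1 + z\<^sup>2) / w + z) \<le> norm (1 + z\<^sup>2) / norm w + norm z"
        using norm_triangle_ineq[of "(1 + z\<^sup>2) / w" z] by (simp add: norm_divide)
      also have "\<dots> \<le> norm (1 + z\<^sup>2) / Im z + norm z"
        using w assms nz by (intro add_right_mono divide_left_mono) auto
      finally show "norm ((1 + z\<^sup>2) / w + z) \<le> norm (1 + z\<^sup>2) / Im z + norm z" .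
    qed (use pos in auto)
    finally show ?thesis .
  qed
  then show ?thesis by blast
next
  case (Suc m)
  then show ?thesis
    using cauchy_kernel_Suc_bound[of "Im z" z "norm z" m] assms by auto
qed

section \<open>Holomorphy of the Cauchy transform and its partial derivatives\<close>

definition cauchy_transform :: "nat \<Rightarrow> (real \<Rightarrow> real) \<Rightarrow> complex \<Rightarrow> complex" where
  "cauchy_transform n F z = (LINT \<xi>|lborel. of_real (F \<xi>) * cauchy_kernel n z \<xi>)"

text \<open>The weight matches the decay of all the kernels. This isolates what the pointwise and
  distributional results need from \<open>F\<close>, free of the exponent \<open>p\<close>.\<close>

locale cauchy_integrable =
  fixes F :: "real \<Rightarrow> real"
  assumes F_meas [measurable]: "F \<in> borel_measurable borel"
    and F_integrable: "integrable lborel (\<lambda>\<xi>. F \<xi> / (1 + \<xi>\<^sup>2))"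
begin

lemma integrable_mult_bounded:
  fixes k :: "real \<Rightarrow> 'a :: {banach, second_countable_topology, real_normed_algebra_1}"
  assumes [measurable]: "k \<in> borel_measurable borel" and k: "\<And>\<xi>. norm (k \<xi>) \<le> C / (1 + \<xi>\<^sup>2)"
  shows "integrable lborel (\<lambda>\<xi>. of_real (F \<xi>) * k \<xi>)"
proof (rule Bochner_Integration.integrable_bound)
  show "integrable lborel (\<lambda>\<xi>. C * (F \<xi> / (1 + \<xi>\<^sup>2)))"
    by (intro integrable_mult_right F_integrable)
  have "norm (of_real (F \<xi>) * k \<xi>) \<le> norm (C * (F \<xi> / (1 + \<xi>\<^sup>2)))" for \<xi>
  proof -
    have "norm (of_real (F \<xi>) * k \<xi>) \<le> norm (of_real (F \<xi>) :: 'a) * norm (k \<xi>)"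
      by (rule norm_mult_ineq)
    also have "\<dots> \<le> \<bar>F \<xi>\<bar> * (\<bar>C\<bar> / (1 + \<xi>\<^sup>2))"
    proof -
      have "norm (k \<xi>) \<le> \<bar>C\<bar> / (1 + \<xi>\<^sup>2)"
        by (rule order_trans[OF k divide_right_mono]) auto
      then show ?thesis by (simp add: mult_left_mono del: times_divide_eq_right)
    qed
    also have "\<dots> = norm (C * (F \<xi> / (1 + \<xi>\<^sup>2)))"
      by (simp add: abs_mult mult_ac)
    finally show ?thesis .
  qed
  then show "AE \<xi> in lborel. norm (of_real (F \<xi>) * k \<xi>) \<le> norm (C * (F \<xi> / (1 + \<xi>\<^sup>2)))"
    by simp
qed (simp add: borel_measurable_times)

lemma integrable_cauchy:
  assumes "Im z > 0"
  shows "integrable lborel (\<lambda>\<xi>. of_real (F \<xi>) * cauchy_kernel n z \<xi>)"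
  using cauchy_kernel_bound[OF assms, of n] by (auto intro: integrable_mult_bounded)

lemma DERIV_cauchy_transform:
  assumes "Im z > 0"
  shows "(cauchy_transform n F has_field_derivative cauchy_transform (Suc n) F z) (at z)"
  unfolding cauchy_transform_def
proof (rule has_field_derivative_integral)
  \<comment> \<open>With half the height as radius, the ball stays at height at least
    \<open>b\<close> and within norm \<open>norm z + b\<close>, so a single
    \<open>kernel_const\<close> dominates the derivatives on all of it.\<close>
  define b where "b = Im z / 2"
  show b0: "b > 0" using assms by (simp add: b_def)
  have near: "b \<le> Im w" "norm w \<le> norm z + b" if "w \<in> ball z b" for w
    using that abs_Im_le_cmod[of "z - w"] norm_triangle_ineq2[of w z]
    by (auto simp: dist_norm b_def norm_minus_commute)
  then have pos: "Im w > 0" if "w \<in> ball z b" for w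
    using that b0 by fastforce
  show "((\<lambda>w. of_real (F x) * cauchy_kernel n w x) has_field_derivative
      of_real (F x) * cauchy_kernel (Suc n) w x) (at w)" if "w \<in> ball z b" for w x
    by (intro DERIV_cmult DERIV_cauchy_kernel pos that)
  show "norm (of_real (F x) * cauchy_kernel (Suc n) w x)
      \<le> kernel_const (Suc n) b (norm z + b) * \<bar>F x / (1 + x\<^sup>2)\<bar>" if "w \<in> ball z b" for w x
    using mult_left_mono[OF cauchy_kernel_Suc_bound[OF b0 near[OF that], of n x], of "\<bar>F x\<bar>"]
    by (simp add: norm_mult mult_ac)
  show "integrable lborel (\<lambda>x. kernel_const (Suc n) b (norm z + b) * \<bar>F x / (1 + x\<^sup>2)\<bar>)"
    using F_integrable by (intro integrable_mult_right integrable_abs)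
  show "integrable lborel (\<lambda>x. of_real (F x) * cauchy_kernel n w x)" if "w \<in> ball z b" for w
    by (rule integrable_cauchy[OF pos[OF that]])
qed simp

lemma Im_cauchy_transform:
  assumes "Im z > 0"
  shows "integrable lborel (\<lambda>\<xi>. F \<xi> * Im (cauchy_kernel n z \<xi>))"
    and "Im (cauchy_transform n F z) = (LINT \<xi>|lborel. F \<xi> * Im (cauchy_kernel n z \<xi>))"
  using integrable_Im[OF integrable_cauchy[OF assms, of n]]
    integral_Im[OF integrable_cauchy[OF assms, of n]]
  by (simp_all add: cauchy_transform_def)

text \<open>Chain rule along a horizontal line, whose direction is \<open>1\<close>. The real part
  is needed as well because differentiation in \<open>y\<close> exchanges the two parts.\<close>

lemma DERIV_x:
  assumes "y > 0"
  shows "((\<lambda>t. Im (cauchy_transform n F (Complex t y))) has_real_derivative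
            Im (cauchy_transform (Suc n) F (Complex x y))) (at x)"
    and "((\<lambda>t. Re (cauchy_transform n F (Complex t y))) has_real_derivative
            Re (cauchy_transform (Suc n) F (Complex x y))) (at x)"
proof -
  have "((\<lambda>t. Complex t y) has_vector_derivative 1) (at x)"
    by (auto intro!: derivative_eq_intros simp: Complex_eq)
  from field_vector_diff_chain_at[OF this DERIV_cauchy_transform] assms
  have *: "((\<lambda>t. cauchy_transform n F (Complex t y)) has_vector_derivative
      cauchy_transform (Suc n) F (Complex x y)) (at x)"
    by (simp add: comp_def)
  show "((\<lambda>t. Im (cauchy_transform n F (Complex t y))) has_real_derivative
            Im (cauchy_transform (Suc n) F (Complex x y))) (at x)"
    "((\<lambda>t. Re (cauchy_transform n F (Complex t y))) has_real_derivative
            Re (cauchy_transform (Suc n) F (Complex x y))) (at x)"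
    using bounded_linear.has_vector_derivative[OF bounded_linear_Im *] bounded_linear.has_vector_derivative[OF bounded_linear_Re *]
    by (simp_all add: has_real_derivative_iff_has_vector_derivative)
qed

text \<open>Chain rule along a vertical line: the direction \<open>\<i>\<close> multiplies the
  complex derivative, and \<open>Im (\<i> * w) = Re w\<close>,
  \<open>Re (\<i> * w) = - Im w\<close>. These are the Cauchy-Riemann equations.\<close>

lemma DERIV_y:
  assumes "y > 0"
  shows "((\<lambda>t. Im (cauchy_transform n F (Complex x t))) has_real_derivative
            Re (cauchy_transform (Suc n) F (Complex x y))) (at y)"
    and "((\<lambda>t. Re (cauchy_transform n F (Complex x t))) has_real_derivative
            - Im (cauchy_transform (Suc n) F (Complex x y))) (at y)"
proof -
  have "((\<lambda>t. Complex x t) has_vector_derivative \<i>) (at y)"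
    by (auto intro!: derivative_eq_intros simp: Complex_eq)
  from field_vector_diff_chain_at[OF this DERIV_cauchy_transform] assms
  have *: "((\<lambda>t. cauchy_transform n F (Complex x t)) has_vector_derivative
      \<i> * cauchy_transform (Suc n) F (Complex x y)) (at y)"
    by (simp add: comp_def)
  show "((\<lambda>t. Im (cauchy_transform n F (Complex x t))) has_real_derivative
            Re (cauchy_transform (Suc n) F (Complex x y))) (at y)"
    "((\<lambda>t. Re (cauchy_transform n F (Complex x t))) has_real_derivative
            - Im (cauchy_transform (Suc n) F (Complex x y))) (at y)"
    using bounded_linear.has_vector_derivative[OF bounded_linear_Im *] bounded_linear.has_vector_derivative[OF bounded_linear_Re *]
    by (simp_all add: has_real_derivative_iff_has_vector_derivative)
qed

end

subsection \<open>Poisson integrals as imaginary parts\<close>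

lemma iterated_deriv_eqI:
  fixes g :: "nat \<Rightarrow> real \<Rightarrow> real"
  assumes "\<And>k x. (g k has_real_derivative g (Suc k) x) (at x)"
  shows "(deriv ^^ n) (g 0) = g n"
proof (induction n)
  case (Suc n)
  then show ?case using assms[of n] by (auto intro!: DERIV_imp_deriv)
qed simp

text \<open>The regularising term is real, so the imaginary part depends on the node and
  \<open>x\<close> only through their difference. Differentiation in the node thus reduces to
  differentiation in \<open>z\<close>, with a change of sign.\<close>

lemma Im_cauchy_kernel_shift:
  "Im (cauchy_kernel n (Complex x y) \<eta>) = Im (cauchy_kernel n (Complex (x - \<eta>) y) 0)"
proof -
  have "of_real \<eta> - Complex x y = of_real 0 - Complex (x - \<eta>) y"
    by (simp add: complex_eq_iff)
  then show ?thesis by (simp add: cauchy_kernel_def)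
qed

lemma DERIV_Im_cauchy_kernel_node:
  assumes "y > 0"
  shows "((\<lambda>\<eta>. Im (cauchy_kernel n (Complex x y) \<eta>)) has_real_derivative
           - Im (cauchy_kernel (Suc n) (Complex x y) \<eta>)) (at \<eta>)"
proof -
  have "((\<lambda>t. Complex (x - t) y) has_vector_derivative -1) (at \<eta>)"
    by (auto intro!: derivative_eq_intros simp: Complex_eq)
  from field_vector_diff_chain_at[OF this DERIV_cauchy_kernel] assms
  have *: "((\<lambda>t. cauchy_kernel n (Complex (x - t) y) 0) has_vector_derivative
      - cauchy_kernel (Suc n) (Complex (x - \<eta>) y) 0) (at \<eta>)"
    by (simp add: comp_def)
  show ?thesis
    using bounded_linear.has_vector_derivative[OF bounded_linear_Im *]
    by (simp add: has_real_derivative_iff_has_vector_derivative Im_cauchy_kernel_shift[of _ x])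
qed

lemma iterated_deriv_poisson_kernel:
  assumes "y > 0"
  shows "(deriv ^^ n) (\<lambda>\<eta>. poisson_kernel y (\<eta> - x)) =
         (\<lambda>\<eta>. (-1) ^ n * Im (cauchy_kernel n (Complex x y) \<eta>))"
proof -
  have "((\<lambda>\<eta>. (-1) ^ k * Im (cauchy_kernel k (Complex x y) \<eta>)) has_real_derivative
      (-1) ^ Suc k * Im (cauchy_kernel (Suc k) (Complex x y) \<eta>)) (at \<eta>)" for k \<eta>
    using DERIV_cmult[OF DERIV_Im_cauchy_kernel_node[OF assms, of k x \<eta>], of "(-1) ^ k"] by simp
  from iterated_deriv_eqI[of "\<lambda>k \<eta>. (-1) ^ k * Im (cauchy_kernel k (Complex x y) \<eta>)", OF this, of n]
  show ?thesis
    by (simp add: Im_cauchy_kernel_0 poisson_kernel_def[abs_def])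
qed

text \<open>The antiderivative \<open>arctan (x / y) / pi\<close> has limits \<open>-1/2\<close> and
  \<open>1/2\<close>; for a nonnegative integrand the fundamental theorem on the whole line yields
  integrability along with the value.\<close>

lemma poisson_kernel_integral:
  assumes "y > 0"
  shows "integrable lborel (poisson_kernel y)" "(LINT x|lborel. poisson_kernel y x) = 1"
proof -
  let ?G = "\<lambda>x. arctan (x / y) / pi"
  have d: "DERIV ?G x :> poisson_kernel y x" for x
    using assms unfolding poisson_kernel_def
    by (auto intro!: derivative_eq_intros simp: divide_simps power2_eq_square)
  have c: "isCont (poisson_kernel y) x" for x
    using assms unfolding poisson_kernel_def
    by (auto intro!: continuous_intros simp: add_nonneg_eq_0_iff)
  have n: "0 \<le> poisson_kernel y x" for x
    using assms by (simp add: poisson_kernel_def)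
  have "filterlim (\<lambda>x. x / y) at_top at_top"
    using filterlim_tendsto_pos_mult_at_top[OF tendsto_const[of "1 / y"] _ filterlim_ident] assms by simp
  then have t: "(?G \<longlongrightarrow> (pi / 2) / pi) at_top"
    by (intro tendsto_divide tendsto_const filterlim_compose[OF tendsto_arctan_at_top]) auto
  have b: "(?G \<longlongrightarrow> - (pi / 2) / pi) at_bot"
    unfolding filterlim_at_bot_mirror using tendsto_minus[OF t] by (simp add: arctan_minus)
  note FTC = interval_integral_FTC_nonneg[of "-\<infinity>" "\<infinity>" ?G "poisson_kernel y" "- (pi / 2) / pi" "(pi / 2) / pi"]
  have u: "einterval (-\<infinity>) \<infinity> = UNIV" by (auto simp: einterval_def)
  have "set_integrable lborel (einterval (-\<infinity>) \<infinity>) (poisson_kernel y)"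
    by (rule FTC) (use d c n t b in \<open>auto simp: ereal_tendsto_simps\<close>)
  then show "integrable lborel (poisson_kernel y)"
    by (simp add: u set_integrable_def)
  have "(LBINT x=-\<infinity>..\<infinity>. poisson_kernel y x) = (pi / 2) / pi - - (pi / 2) / pi"
    by (rule FTC) (use d c n t b in \<open>auto simp: ereal_tendsto_simps\<close>)
  then show "(LINT x|lborel. poisson_kernel y x) = 1"
    by (simp add: interval_lebesgue_integral_def u set_lebesgue_integral_def)
qed

lemma integrable_inverse_one_plus_square: "integrable lborel (\<lambda>x::real. 1 / (1 + x\<^sup>2))"
  using integrable_mult_right[OF poisson_kernel_integral(1)[of 1], of pi]
  by (simp add: poisson_kernel_def add.commute)

text \<open>This is integration by parts without boundary terms, once \<open>G\<close> is taken to
  be a product.\<close>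

lemma integral_derivative_line_eq_0:
  fixes G g :: "real \<Rightarrow> real"
  assumes "\<And>x. (G has_real_derivative g x) (at x)" "continuous_on UNIV g" "integrable lborel g"
    and "(G \<longlongrightarrow> 0) at_top" "(G \<longlongrightarrow> 0) at_bot"
  shows "(LINT x|lborel. g x) = 0"
proof -
  have u: "einterval (-\<infinity>) \<infinity> = UNIV" by (auto simp: einterval_def)
  have "(LBINT x=-\<infinity>..\<infinity>. g x) = 0 - 0"
    by (rule interval_integral_FTC_integrable[where F = G])
      (use assms in \<open>auto simp: ereal_tendsto_simps u set_integrable_def continuous_on_eq_continuous_at
        simp flip: has_real_derivative_iff_has_vector_derivative\<close>)
  then show ?thesis
    by (simp add: interval_lebesgue_integral_def u set_lebesgue_integral_def)
qed

text \<open>The exponent is chosen so that a factor of quadratic growth still leaves the integrable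
  \<open>1 / (1 + x^2)\<close>. Expanding the square shows that the seminorms with
  \<open>k = 0, 2, 4\<close> suffice.\<close>

lemma schwartz_decay:
  assumes "schwartz \<phi>"
  shows "\<exists>C\<ge>0. \<forall>x. \<bar>(deriv ^^ m) \<phi> x\<bar> \<le> C / (1 + x\<^sup>2)\<^sup>2"
proof -
  let ?f = "\<lambda>x. \<bar>(deriv ^^ m) \<phi> x\<bar>"
  have "\<exists>C. \<forall>x. \<bar>x\<bar> ^ k * ?f x \<le> C" for k
    using assms unfolding schwartz_def by blast
  then obtain C where C: "\<And>k x. \<bar>x\<bar> ^ k * ?f x \<le> C k" by metis
  let ?C = "C 0 + 2 * C 2 + C 4"
  have *: "(1 + x\<^sup>2)\<^sup>2 * ?f x \<le> ?C" for x
  proof -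
    have "(1 + x\<^sup>2)\<^sup>2 * ?f x = \<bar>x\<bar> ^ 0 * ?f x + 2 * (\<bar>x\<bar> ^ 2 * ?f x) + \<bar>x\<bar> ^ 4 * ?f x"
      by (simp add: power2_sum distrib_right)
    then show ?thesis using C[of x 0] C[of x 2] C[of x 4] by linarith
  qed
  have pos: "(1 + x\<^sup>2)\<^sup>2 > 0" for x :: real
    by (intro zero_less_power add_pos_nonneg) auto
  have "?f x \<le> ?C / (1 + x\<^sup>2)\<^sup>2" for x
    using *[of x] pos[of x] by (simp add: pos_le_divide_eq mult.commute)
  moreover have "?C \<ge> 0" using *[of 0] by (smt (verit) abs_ge_zero mult_nonneg_nonneg zero_le_power2)
  ultimately show ?thesis by blast
qed

context cauchy_integrable
begin

lemma poisson_u_integrable: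
  assumes "y > 0"
  shows "integrable lborel (\<lambda>\<xi>. F \<xi> * (deriv ^^ n) (\<lambda>\<eta>. poisson_kernel y (\<eta> - x)) \<xi>)"
  using integrable_mult_right[OF Im_cauchy_transform(1)[of "Complex x y" n], of "(-1) ^ n"] assms
  by (simp add: iterated_deriv_poisson_kernel mult_ac)

text \<open>The sign in the definition of \<open>poisson_u\<close> cancels the one that arises from
  differentiating the kernel in the node instead of in \<open>x\<close>.\<close>

lemma poisson_u_eq:
  assumes "y > 0"
  shows "poisson_u n F y x = Im (cauchy_transform n F (Complex x y))"
proof -
  have "poisson_u n F y x = (-1) ^ n * (LINT \<xi>|lborel. (-1) ^ n * (F \<xi> * Im (cauchy_kernel n (Complex x y) \<xi>)))"
    unfolding poisson_u_def iterated_deriv_poisson_kernel[OF assms] by (simp add: mult_ac)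
  also have "\<dots> = Im (cauchy_transform n F (Complex x y))"
    unfolding integral_mult_right_zero using assms
    by (simp add: Im_cauchy_transform(2) flip: power_mult_distrib mult.assoc)
  finally show ?thesis .
qed

lemma poisson_U_eq:
  assumes "y > 0"
  shows "poisson_U F y = (\<lambda>x. Im (cauchy_transform 0 F (Complex x y)))"
  unfolding poisson_U_def using assms
  by (simp add: Im_cauchy_transform(2) Im_cauchy_kernel_0 poisson_kernel_def power2_commute)

lemma iterated_deriv_poisson_U:
  assumes "y > 0"
  shows "(deriv ^^ n) (poisson_U F y) = (\<lambda>x. Im (cauchy_transform n F (Complex x y)))"
  unfolding poisson_U_eq[OF assms]
  by (rule iterated_deriv_eqI[of "\<lambda>n x. Im (cauchy_transform n F (Complex x y))"]) (rule DERIV_x[OF assms])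

lemma has_nth_derivs_poisson_U:
  assumes "y > 0"
  shows "has_nth_derivs n (poisson_U F y)"
  unfolding has_nth_derivs_def iterated_deriv_poisson_U[OF assms]
  by (simp add: DERIV_x[OF assms])

lemma continuous_on_cauchy_transform:
  "continuous_on {z. snd z > 0} (\<lambda>z. cauchy_transform n F (Complex (fst z) (snd z)))"
proof (rule continuous_on_compose2[of "{z. Im z > 0}" "cauchy_transform n F"])
  show "continuous_on {z. Im z > 0} (cauchy_transform n F)"
    by (rule DERIV_continuous_on, rule has_field_derivative_at_within, rule DERIV_cauchy_transform) simp
  show "continuous_on {z. snd z > 0} (\<lambda>z. Complex (fst z) (snd z))"
    unfolding Complex_eq by (intro continuous_intros)
qed auto

lemma harmonic_poisson_u: "harmonic_on {z. snd z > 0} (\<lambda>(x, y). poisson_u n F y x)"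
proof -
  define I R where "I k z = Im (cauchy_transform k F (Complex (fst z) (snd z)))"
    and "R k z = Re (cauchy_transform k F (Complex (fst z) (snd z)))" for k z
  have cont: "continuous_on {z. snd z > 0} (I k)" "continuous_on {z. snd z > 0} (R k)" for k
    unfolding I_def R_def by (intro continuous_intros continuous_on_cauchy_transform)+
  have "open {z::real \<times> real. snd z > 0}"
    by (intro open_Collect_less continuous_intros)
  moreover have "continuous_on {z. snd z > 0} (\<lambda>(x, y). poisson_u n F y x)"
    using cont(1)[of n] by (rule continuous_on_eq) (auto simp: poisson_u_eq I_def)
  moreover have "((\<lambda>t. poisson_u n F t a) has_real_derivative R (Suc n) (a, b)) (at b)" if "b > 0" for a b
  \<comment> \<open>\<open>poisson_u\<close> is identified with the imaginary part only at positive
    height, so the \<open>y\<close>-derivative is transferred on the open half-line.\<close>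
  proof (rule has_field_derivative_transform_within_open)
    show "((\<lambda>t. Im (cauchy_transform n F (Complex a t))) has_real_derivative R (Suc n) (a, b)) (at b)"
      unfolding R_def using DERIV_y[OF that] by simp
    show "open {0::real<..}" by simp
  qed (use that in \<open>auto simp: poisson_u_eq\<close>)
  moreover have "((\<lambda>t. poisson_u n F b t) has_real_derivative I (Suc n) (a, b)) (at a)" if "b > 0" for a b
    using DERIV_x(1)[OF that, of n a] that by (simp add: I_def poisson_u_eq)
  moreover have "((\<lambda>t. I (Suc n) (t, b)) has_real_derivative I (n + 2) (a, b)) (at a)"
    "((\<lambda>t. I (Suc n) (a, t)) has_real_derivative R (n + 2) (a, b)) (at b)"
    "((\<lambda>t. R (Suc n) (t, b)) has_real_derivative R (n + 2) (a, b)) (at a)"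
    "((\<lambda>t. R (Suc n) (a, t)) has_real_derivative - I (n + 2) (a, b)) (at b)" if "b > 0" for a b
    using DERIV_x[OF that, of "Suc n" a] DERIV_y[OF that, of "Suc n" a] by (simp_all add: I_def R_def)
  moreover have "continuous_on {z. snd z > 0} (\<lambda>z. - I (n + 2) z)"
    by (intro continuous_on_minus cont)
  ultimately show ?thesis
    unfolding harmonic_on_def
    \<comment> \<open>By Cauchy-Riemann the first partials are \<open>I (Suc n)\<close> and
      \<open>R (Suc n)\<close>, both mixed partials are \<open>R (n + 2)\<close>, and the pure
      second partials are \<open>I (n + 2)\<close> and its negative, which sum to zero.\<close>
    by - (intro conjI, assumption, rule exI[of _ "I (Suc n)"], rule exI[of _ "R (Suc n)"], rule exI[of _ "I (n + 2)"],
      rule exI[of _ "R (n + 2)"], rule exI[of _ "R (n + 2)"], rule exI[of _ "\<lambda>z. - I (n + 2) z"], simp add: cont)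
qed

section \<open>Pairing with Schwartz functions and the distributional derivative\<close>

lemma poisson_u_growth:
  assumes "y > 0"
  shows "\<exists>C\<ge>0. \<forall>x. \<bar>poisson_u n F y x\<bar> \<le> C * (1 + x\<^sup>2)"
proof -
  obtain C where C: "C \<ge> 0" "\<And>x \<xi>. \<bar>Im (cauchy_kernel n (Complex x y) \<xi>)\<bar> \<le> C * (1 + x\<^sup>2) / (1 + \<xi>\<^sup>2)"
    using abs_Im_cauchy_kernel_bound[OF assms, of n] by blast
  let ?M = "LINT \<xi>|lborel. \<bar>F \<xi> / (1 + \<xi>\<^sup>2)\<bar>"
  have "\<bar>poisson_u n F y x\<bar> \<le> C * ?M * (1 + x\<^sup>2)" for x
  proof -
    have "\<bar>poisson_u n F y x\<bar> \<le> (LINT \<xi>|lborel. C * (1 + x\<^sup>2) * \<bar>F \<xi> / (1 + \<xi>\<^sup>2)\<bar>)"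
    proof -
      have "norm (LINT \<xi>|lborel. F \<xi> * Im (cauchy_kernel n (Complex x y) \<xi>))
          \<le> (LINT \<xi>|lborel. C * (1 + x\<^sup>2) * \<bar>F \<xi> / (1 + \<xi>\<^sup>2)\<bar>)"
      proof (rule Bochner_Integration.integral_norm_bound_integral)
        show "norm (F \<xi> * Im (cauchy_kernel n (Complex x y) \<xi>)) \<le> C * (1 + x\<^sup>2) * \<bar>F \<xi> / (1 + \<xi>\<^sup>2)\<bar>" for \<xi>
          using mult_left_mono[OF C(2)[of x \<xi>], of "\<bar>F \<xi>\<bar>"] by (simp add: abs_mult mult_ac)
      qed (use assms in \<open>intro Im_cauchy_transform(1) integrable_mult_right integrable_abs F_integrable; simp\<close>)+
      then show ?thesis using assms by (simp add: poisson_u_eq Im_cauchy_transform(2))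
    qed
    also have "\<dots> = C * ?M * (1 + x\<^sup>2)" unfolding integral_mult_right_zero by simp
    finally show ?thesis .
  qed
  moreover have "C * ?M \<ge> 0" using C(1) by (intro mult_nonneg_nonneg integral_nonneg_AE) auto
  ultimately show ?thesis by blast
qed

lemma continuous_poisson_u:
  assumes "y > 0"
  shows "continuous_on UNIV (poisson_u n F y)"
proof -
  have "continuous_on UNIV (\<lambda>x. Im (cauchy_transform n F (Complex x y)))"
    using DERIV_x(1)[OF assms] by (rule DERIV_continuous_on[OF has_field_derivative_at_within])
  then show ?thesis using poisson_u_eq[OF assms, of n] by presburger
qed

text \<open>Quadratic growth against decay of order four leaves a multiple of
  \<open>1 / (1 + x^2)\<close>, which is integrable and vanishes at both ends. These facts are
  exactly the hypotheses of the integration by parts.\<close>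

lemma poisson_u_times_schwartz:
  assumes y: "y > 0" and \<phi>: "schwartz \<phi>"
  shows "integrable lborel (\<lambda>x. poisson_u n F y x * (deriv ^^ m) \<phi> x)"
    and "((\<lambda>x. poisson_u n F y x * (deriv ^^ m) \<phi> x) \<longlongrightarrow> 0) at_top"
    and "((\<lambda>x. poisson_u n F y x * (deriv ^^ m) \<phi> x) \<longlongrightarrow> 0) at_bot"
    and "continuous_on UNIV (\<lambda>x. poisson_u n F y x * (deriv ^^ m) \<phi> x)"
proof -
  let ?f = "\<lambda>x. poisson_u n F y x * (deriv ^^ m) \<phi> x"
  obtain C where C: "C \<ge> 0" "\<And>x. \<bar>poisson_u n F y x\<bar> \<le> C * (1 + x\<^sup>2)"
    using poisson_u_growth[OF y] by blast
  obtain D where D: "D \<ge> 0" "\<And>x. \<bar>(deriv ^^ m) \<phi> x\<bar> \<le> D / (1 + x\<^sup>2)\<^sup>2"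
    using schwartz_decay[OF \<phi>] by blast
  have bd: "norm (?f x) \<le> C * D * (1 / (1 + x\<^sup>2))" for x
  proof -
    have pos: "1 + x\<^sup>2 > 0" by (simp add: add_pos_nonneg)
    have "norm (?f x) \<le> C * (1 + x\<^sup>2) * (D / (1 + x\<^sup>2)\<^sup>2)"
      unfolding real_norm_def abs_mult using C D pos by (intro mult_mono) auto
    also have "\<dots> = C * D * (1 / (1 + x\<^sup>2))"
      using pos by (simp add: power2_eq_square)
    finally show ?thesis .
  qed
  show cont: "continuous_on UNIV ?f"
  proof -
    have "\<And>x. ((deriv ^^ m) \<phi> has_real_derivative (deriv ^^ Suc m) \<phi> x) (at x)"
      using \<phi> unfolding schwartz_def by blast
    from DERIV_continuous_on[OF has_field_derivative_at_within[OF this]] show ?thesis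
      by (intro continuous_on_mult continuous_poisson_u[OF y])
  qed
  have int: "integrable lborel (\<lambda>x::real. C * D * (1 / (1 + x\<^sup>2)))"
    by (intro integrable_mult_right integrable_inverse_one_plus_square)
  have "?f \<in> borel_measurable lborel"
    using borel_measurable_continuous_onI[OF cont] by simp
  then show "integrable lborel ?f"
    by (rule Bochner_Integration.integrable_bound[OF int _ AE_I2]) (rule order_trans[OF bd], simp only: real_norm_def abs_ge_self)
  have lim: "((\<lambda>x::real. C * D * (1 / (1 + x\<^sup>2))) \<longlongrightarrow> 0) at_top"
  proof -
    have "filterlim (\<lambda>x::real. 1 + x\<^sup>2) at_top at_top"
      by (intro filterlim_tendsto_add_at_top[OF tendsto_const] filterlim_pow_at_top filterlim_ident) simp
    from tendsto_mult_right_zero[OF tendsto_inverse_0_at_top[OF this]]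
    show ?thesis by (simp add: inverse_eq_divide)
  qed
  show "(?f \<longlongrightarrow> 0) at_top"
    by (rule Lim_null_comparison[OF _ lim]) (use bd in auto)
  have "((\<lambda>x::real. C * D * (1 / (1 + x\<^sup>2))) \<longlongrightarrow> 0) at_bot"
    unfolding filterlim_at_bot_mirror using lim by simp
  then show "(?f \<longlongrightarrow> 0) at_bot"
    by (rule Lim_null_comparison[rotated]) (use bd in auto)
qed

lemma poisson_u_distr_deriv_step:
  assumes y: "y > 0" and \<phi>: "schwartz \<phi>"
  shows "(LINT x|lborel. poisson_u (Suc n) F y x * (deriv ^^ m) \<phi> x) =
         - (LINT x|lborel. poisson_u n F y x * (deriv ^^ Suc m) \<phi> x)"
proof -
  note S = poisson_u_times_schwartz[OF y \<phi>]
  \<comment> \<open>The integrand is the derivative of the product of \<open>poisson_u n F y\<close>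
    and \<open>(deriv ^^ m) \<phi>\<close>.\<close>
  have "(LINT x|lborel. poisson_u (Suc n) F y x * (deriv ^^ m) \<phi> x + poisson_u n F y x * (deriv ^^ Suc m) \<phi> x) = 0"
  proof (rule integral_derivative_line_eq_0)
    show "((\<lambda>x. poisson_u n F y x * (deriv ^^ m) \<phi> x) has_real_derivative
       poisson_u (Suc n) F y x * (deriv ^^ m) \<phi> x + poisson_u n F y x * (deriv ^^ Suc m) \<phi> x) (at x)" for x
    proof -
      have "(poisson_u n F y has_real_derivative poisson_u (Suc n) F y x) (at x)"
        using DERIV_x(1)[OF y, of n x] poisson_u_eq[OF y] by presburger
      moreover have "((deriv ^^ m) \<phi> has_real_derivative (deriv ^^ Suc m) \<phi> x) (at x)"
        using \<phi> unfolding schwartz_def by blast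
      ultimately show ?thesis by (auto intro!: derivative_eq_intros simp: mult_ac)
    qed
  qed (intro S continuous_intros Bochner_Integration.integrable_add)+
  then show ?thesis
    using S(1)[of "Suc n" m] S(1)[of n "Suc m"] by (simp add: add_eq_0_iff)
qed

lemma poisson_u_distr_deriv:
  assumes y: "y > 0"
  shows "is_nth_distr_deriv n (poisson_U F y) (poisson_u n F y)"
proof -
  have U: "poisson_U F y = poisson_u 0 F y"
    using poisson_U_eq[OF y] poisson_u_eq[OF y, of 0] by presburger
  \<comment> \<open>The order \<open>m\<close> on the test function must be arbitrary in the
    induction, since each step moves one derivative onto it.\<close>
  have "(LINT x|lborel. poisson_u n F y x * (deriv ^^ m) \<phi> x) =
      (-1) ^ n * (LINT x|lborel. poisson_U F y x * (deriv ^^ (n + m)) \<phi> x)" if "schwartz \<phi>" for \<phi> m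
  proof (induction n arbitrary: m)
    case (Suc n)
    show ?case
      unfolding poisson_u_distr_deriv_step[OF y that] Suc.IH by simp
  qed (simp add: U)
  from this[where m = 0] poisson_u_times_schwartz(1)[OF y, where m = 0] show ?thesis
    by (auto simp: is_nth_distr_deriv_def)
qed

end

subsection \<open>Contraction in the mean of order p\<close>

text \<open>A crude substitute for Minkowski's inequality on \<open>p\<close>-th powers, from
  \<open>\<bar>a + b\<bar> \<le> 2 * max \<bar>a\<bar> \<bar>b\<bar>\<close>. The constant does no
  harm, as only integrability, boundedness and smallness are deduced from it.\<close>

lemma powr_add_le:
  fixes a b p :: real
  assumes "0 \<le> p"
  shows "\<bar>a + b\<bar> powr p \<le> 2 powr p * (\<bar>a\<bar> powr p + \<bar>b\<bar> powr p)"
proof -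
  have "\<bar>a + b\<bar> powr p \<le> (2 * max \<bar>a\<bar> \<bar>b\<bar>) powr p"
    using assms by (intro powr_mono2) auto
  also have "\<dots> = 2 powr p * max \<bar>a\<bar> \<bar>b\<bar> powr p"
    by (rule powr_mult)
  also have "\<dots> \<le> 2 powr p * (\<bar>a\<bar> powr p + \<bar>b\<bar> powr p)"
    by (intro mult_left_mono) (auto simp: max_def)
  finally show ?thesis .
qed

lemma convex_on_abs_powr:
  fixes p :: real
  assumes p: "1 \<le> p"
  shows "convex_on UNIV (\<lambda>x. \<bar>x\<bar> powr p)"
proof (rule convex_onI)
  fix t x y :: real
  assume t: "0 < t" "t < 1"
  have scale: "(s * \<bar>v\<bar>) powr p \<le> s * \<bar>v\<bar> powr p" if "0 < s" "s < 1" for s v :: real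
    using that p powr_le_one_le[of s p] by (simp add: powr_mult mult_right_mono)
  have "\<bar>(1 - t) *\<^sub>R x + t *\<^sub>R y\<bar> powr p \<le> ((1 - t) * \<bar>x\<bar> + t * \<bar>y\<bar>) powr p"
    using t p abs_triangle_ineq[of "(1 - t) * x" "t * y"] by (intro powr_mono2) (auto simp: abs_mult)
  also have "\<dots> \<le> (1 - t) * \<bar>x\<bar> powr p + t * \<bar>y\<bar> powr p"
  \<comment> \<open>If one point is zero, the claim reduces to \<open>s powr p \<le> s\<close> on
    the unit interval; otherwise convexity of the power on positive reals applies.\<close>
  proof (cases "x = 0 \<or> y = 0")
    case True
    then show ?thesis using scale[of t y] scale[of "1 - t" x] t by auto
  next
    case False
    then show ?thesis
      using convex_onD[OF powr_convex[OF p], of t "\<bar>x\<bar>" "\<bar>y\<bar>"] t by simp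
  qed
  finally show "\<bar>(1 - t) *\<^sub>R x + t *\<^sub>R y\<bar> powr p \<le> (1 - t) * \<bar>x\<bar> powr p + t * \<bar>y\<bar> powr p" .
qed simp

text \<open>The pointwise bound
  \<open>\<bar>F \<xi>\<bar> \<le> 1 + \<bar>F \<xi>\<bar> powr p\<close> replaces Hoelder's
  inequality and treats all \<open>p \<ge> 1\<close> alike, including \<open>p = 1\<close>.\<close>

lemma Lp_cauchy_integrable:
  assumes "1 \<le> p" "Lp p F"
  shows "cauchy_integrable F"
proof
  show [measurable]: "F \<in> borel_measurable borel"
    using assms by (simp add: Lp_def)
  show "integrable lborel (\<lambda>\<xi>. F \<xi> / (1 + \<xi>\<^sup>2))"
  proof (rule Bochner_Integration.integrable_bound)
    show "integrable lborel (\<lambda>\<xi>. 1 / (1 + \<xi>\<^sup>2) + \<bar>F \<xi>\<bar> powr p)"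
      using assms by (intro Bochner_Integration.integrable_add integrable_inverse_one_plus_square) (simp add: Lp_def)
    have "norm (F \<xi> / (1 + \<xi>\<^sup>2)) \<le> norm (1 / (1 + \<xi>\<^sup>2) + \<bar>F \<xi>\<bar> powr p)" for \<xi>
    proof -
      have pos: "1 + \<xi>\<^sup>2 \<ge> 1" by simp
      have "\<bar>F \<xi>\<bar> \<le> 1 + \<bar>F \<xi>\<bar> powr p"
        using powr_mono[of 1 p "\<bar>F \<xi>\<bar>"] assms by (cases "\<bar>F \<xi>\<bar> \<le> 1") (auto intro: add_increasing2)
      then have "norm (F \<xi> / (1 + \<xi>\<^sup>2)) \<le> (1 + \<bar>F \<xi>\<bar> powr p) / (1 + \<xi>\<^sup>2)"
        using pos by (auto intro!: divide_right_mono)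
      also have "\<dots> \<le> 1 / (1 + \<xi>\<^sup>2) + \<bar>F \<xi>\<bar> powr p"
        using divide_left_mono[OF pos, of "\<bar>F \<xi>\<bar> powr p"] less_le_trans[OF zero_less_one pos]
        by (simp add: add_divide_distrib)
      finally show ?thesis by simp
    qed
    then show "AE \<xi> in lborel. norm (F \<xi> / (1 + \<xi>\<^sup>2)) \<le> norm (1 / (1 + \<xi>\<^sup>2) + \<bar>F \<xi>\<bar> powr p)"
      by simp
  qed simp
qed

section \<open>The Poisson kernel as a probability density\<close>

lemma poisson_kernel_measurable [measurable]: "poisson_kernel y \<in> borel_measurable borel"
  unfolding poisson_kernel_def[abs_def] by measurable

lemma poisson_kernel_nonneg: "y > 0 \<Longrightarrow> 0 \<le> poisson_kernel y x"
  by (simp add: poisson_kernel_def)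

lemma poisson_kernel_le:
  assumes "y > 0"
  shows "poisson_kernel y x \<le> 1 / (pi * y)"
proof -
  have "poisson_kernel y x \<le> y / (pi * y\<^sup>2)"
    unfolding poisson_kernel_def using assms by (intro divide_left_mono) (auto simp: add_nonneg_pos)
  then show ?thesis using assms by (simp add: power2_eq_square)
qed

lemma nn_integral_poisson_kernel:
  "y > 0 \<Longrightarrow> (\<integral>\<^sup>+ t. ennreal (poisson_kernel y t) \<partial>lborel) = 1"
  using poisson_kernel_integral poisson_kernel_nonneg by (subst nn_integral_eq_integral) auto

lemma prob_space_poisson:
  assumes "y > 0"
  shows "prob_space (density lborel (poisson_kernel y))"
proof
  have "emeasure (density lborel (poisson_kernel y)) UNIV = (\<integral>\<^sup>+ x. ennreal (poisson_kernel y x) \<partial>lborel)"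
    by (subst emeasure_density) auto
  also have "\<dots> = 1"
    by (rule nn_integral_poisson_kernel[OF assms])
  finally show "emeasure (density lborel (poisson_kernel y)) (space (density lborel (poisson_kernel y))) = 1"
    by simp
qed

lemma integrable_reflect_translate:
  fixes f :: "real \<Rightarrow> real"
  assumes "integrable lborel f"
  shows "integrable lborel (\<lambda>t. f (x - t))"
  using lborel_integrable_real_affine[OF assms, of "-1" x] by simp

lemma integrable_translate:
  fixes f :: "real \<Rightarrow> real"
  assumes "integrable lborel f"
  shows "integrable lborel (\<lambda>x. f (x - t))"
  using lborel_integrable_real_affine[OF assms, of 1 "-t"] by (simp add: algebra_simps)

lemma integral_translate:
  fixes f :: "real \<Rightarrow> real"
  shows "(LINT x|lborel. f (x - t)) = (LINT x|lborel. f x)"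
  using lborel_integral_real_affine[of 1 f "-t"] by (simp add: algebra_simps)

lemma poisson_U_reflect:
  "poisson_U F y x = (LINT t|lborel. F (x - t) * poisson_kernel y t)"
  unfolding poisson_U_def
  by (subst lborel_integral_real_affine[of "-1" _ x]) simp_all

text \<open>Because the density has mass one, \<open>poisson_U F y x - c\<close> is the mean of
  \<open>F (x - t) - c\<close>, and Jensen's inequality applies. Integrability holds at every
  \<open>x\<close>, since the kernel is bounded by \<open>1 / (pi * y)\<close>. Later
  \<open>c\<close> is a multiple of \<open>F x\<close>.\<close>

lemma poisson_U_jensen:
  assumes p: "1 \<le> p" and F: "Lp p F" and y: "y > 0"
  shows "integrable lborel (\<lambda>t. \<bar>F (x - t) - c\<bar> powr p * poisson_kernel y t)"
    and "\<bar>poisson_U F y x - c\<bar> powr p \<le> (LINT t|lborel. \<bar>F (x - t) - c\<bar> powr p * poisson_kernel y t)"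
proof -
  interpret cauchy_integrable F by (rule Lp_cauchy_integrable[OF p F])
  let ?P = "poisson_kernel y"
  note P = poisson_kernel_integral[OF y] poisson_kernel_nonneg[OF y]
  interpret P: prob_space "density lborel ?P" by (rule prob_space_poisson[OF y])
  have dens: "integrable (density lborel ?P) f \<longleftrightarrow> integrable lborel (\<lambda>t. f t * ?P t)"
    "(LINT t|density lborel ?P. f t) = (LINT t|lborel. f t * ?P t)"
    if "f \<in> borel_measurable borel" for f :: "real \<Rightarrow> real"
    using that P(3) by (auto simp: integrable_density integral_density mult_ac)
  have FP: "integrable lborel (\<lambda>t. F (x - t) * ?P t)"
  proof -
    \<comment> \<open>This is the integrand of \<open>poisson_u\<close> for \<open>n = 0\<close>;
      reflection about \<open>x\<close> and evenness of the kernel turn it into the required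
      form.\<close>
    have "integrable lborel (\<lambda>\<xi>. F \<xi> * ?P (\<xi> - x))"
      using poisson_u_integrable[OF y, of 0 x] by simp
    from integrable_reflect_translate[OF this, of x] show ?thesis
      by (simp add: poisson_kernel_def)
  qed
  show int: "integrable lborel (\<lambda>t. \<bar>F (x - t) - c\<bar> powr p * ?P t)"
  proof (rule Bochner_Integration.integrable_bound)
    show "integrable lborel (\<lambda>t. 2 powr p * (1 / (pi * y) * \<bar>F (x - t)\<bar> powr p + \<bar>c\<bar> powr p * ?P t))"
      using F P(1) integrable_reflect_translate[of "\<lambda>t. \<bar>F t\<bar> powr p" x]
      by (intro integrable_mult_right Bochner_Integration.integrable_add) (auto simp: Lp_def)
    have "norm (\<bar>F (x - t) - c\<bar> powr p * ?P t)
      \<le> norm (2 powr p * (1 / (pi * y) * \<bar>F (x - t)\<bar> powr p + \<bar>c\<bar> powr p * ?P t))" for t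
    proof -
      have "norm (\<bar>F (x - t) - c\<bar> powr p * ?P t) = \<bar>F (x - t) - c\<bar> powr p * ?P t"
        using P(3)[of t] by (simp add: abs_mult)
      also have "\<dots> \<le> 2 powr p * (\<bar>F (x - t)\<bar> powr p + \<bar>c\<bar> powr p) * ?P t"
        using P(3)[of t] powr_add_le[of p "F (x - t)" "- c"] p by (intro mult_right_mono) auto
      also have "\<dots> = 2 powr p * (?P t * \<bar>F (x - t)\<bar> powr p + \<bar>c\<bar> powr p * ?P t)"
        by (simp add: algebra_simps)
      also have "\<dots> \<le> 2 powr p * (1 / (pi * y) * \<bar>F (x - t)\<bar> powr p + \<bar>c\<bar> powr p * ?P t)"
        using poisson_kernel_le[OF y, of t] by (intro mult_left_mono add_right_mono mult_right_mono) auto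
      finally show ?thesis by (rule order_trans) (simp only: real_norm_def abs_ge_self)
    qed
    then show "AE t in lborel. norm (\<bar>F (x - t) - c\<bar> powr p * ?P t)
      \<le> norm (2 powr p * (1 / (pi * y) * \<bar>F (x - t)\<bar> powr p + \<bar>c\<bar> powr p * ?P t))" by simp
  qed simp
  have i: "integrable (density lborel ?P) (\<lambda>t. F (x - t))"
    using FP by (simp add: dens)
  have "\<bar>P.expectation (\<lambda>t. F (x - t) - c)\<bar> powr p \<le> P.expectation (\<lambda>t. \<bar>F (x - t) - c\<bar> powr p)"
    by (rule P.jensens_inequality[where I = UNIV])
      (use int i convex_on_abs_powr[OF p] in \<open>auto simp: dens\<close>)
  moreover have "P.expectation (\<lambda>t. F (x - t) - c) = poisson_U F y x - c"
    using i P.prob_space by (simp add: dens poisson_U_reflect)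
  ultimately show "\<bar>poisson_U F y x - c\<bar> powr p \<le> (LINT t|lborel. \<bar>F (x - t) - c\<bar> powr p * ?P t)"
    by (simp add: dens)
qed

lemma poisson_U_measurable:
  assumes "1 \<le> p" "Lp p F" "y > 0"
  shows "poisson_U F y \<in> borel_measurable borel"
proof -
  interpret cauchy_integrable F by (rule Lp_cauchy_integrable[OF assms(1,2)])
  have "poisson_U F y = poisson_u 0 F y"
    using poisson_U_eq[OF assms(3)] poisson_u_eq[OF assms(3), of 0] by presburger
  then show ?thesis
    using continuous_poisson_u[OF assms(3), of 0] by (simp add: borel_measurable_continuous_onI)
qed

text \<open>The case \<open>s = 0\<close> gives the contraction estimate, the case \<open>s = 1\<close> the approximation estimate.\<close>

lemma nn_integral_poisson_U_diff_le:
  assumes p: "1 \<le> p" and F: "Lp p F" and y: "y > 0"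
  shows "(\<integral>\<^sup>+ x. ennreal (\<bar>poisson_U F y x - s * F x\<bar> powr p) \<partial>lborel)
    \<le> (\<integral>\<^sup>+ t. ennreal (poisson_kernel y t) * (\<integral>\<^sup>+ x. ennreal (\<bar>F (x - t) - s * F x\<bar> powr p) \<partial>lborel) \<partial>lborel)"
proof -
  have [measurable]: "F \<in> borel_measurable borel" using F by (simp add: Lp_def)
  let ?g = "\<lambda>x t. ennreal (poisson_kernel y t) * ennreal (\<bar>F (x - t) - s * F x\<bar> powr p)"
  have "ennreal (\<bar>poisson_U F y x - s * F x\<bar> powr p) \<le> (\<integral>\<^sup>+ t. ?g x t \<partial>lborel)" for x
  proof -
    have "ennreal (\<bar>poisson_U F y x - s * F x\<bar> powr p)
        \<le> ennreal (LINT t|lborel. \<bar>F (x - t) - s * F x\<bar> powr p * poisson_kernel y t)"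
      by (intro ennreal_leI poisson_U_jensen assms)
    also have "\<dots> = (\<integral>\<^sup>+ t. ennreal (\<bar>F (x - t) - s * F x\<bar> powr p * poisson_kernel y t) \<partial>lborel)"
      using poisson_kernel_nonneg[OF y]
      by (intro nn_integral_eq_integral[symmetric] poisson_U_jensen assms) auto
    also have "\<dots> = (\<integral>\<^sup>+ t. ?g x t \<partial>lborel)"
      using poisson_kernel_nonneg[OF y] by (simp add: ennreal_mult' mult.commute)
    finally show ?thesis .
  qed
  then have "(\<integral>\<^sup>+ x. ennreal (\<bar>poisson_U F y x - s * F x\<bar> powr p) \<partial>lborel)
      \<le> (\<integral>\<^sup>+ x. (\<integral>\<^sup>+ t. ?g x t \<partial>lborel) \<partial>lborel)"
    by (intro nn_integral_mono)
  \<comment> \<open>Tonelli: working with nonnegative integrals, the exchange asks only for joint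
    measurability.\<close>
  also have "\<dots> = (\<integral>\<^sup>+ t. (\<integral>\<^sup>+ x. ?g x t \<partial>lborel) \<partial>lborel)"
    by (rule lborel_pair.Fubini'[symmetric]) measurable
  also have "\<dots> = (\<integral>\<^sup>+ t. ennreal (poisson_kernel y t) *
      (\<integral>\<^sup>+ x. ennreal (\<bar>F (x - t) - s * F x\<bar> powr p) \<partial>lborel) \<partial>lborel)"
    by (intro nn_integral_cong nn_integral_cmult) simp
  finally show ?thesis .
qed

lemma integral_le_of_nn_integral_le:
  fixes f :: "'a \<Rightarrow> real"
  assumes "f \<in> borel_measurable M" "\<And>x. 0 \<le> f x" "(\<integral>\<^sup>+ x. ennreal (f x) \<partial>M) \<le> ennreal B" "0 \<le> B"
  shows "integrable M f" "(LINT x|M. f x) \<le> B"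
proof -
  show i: "integrable M f"
    using assms by (intro integrableI_nonneg) (auto simp: le_less_trans)
  from nn_integral_eq_integral[OF i] assms show "(LINT x|M. f x) \<le> B"
    by (simp add: ennreal_le_iff)
qed

lemma poisson_U_Lp:
  assumes p: "1 \<le> p" and F: "Lp p F" and y: "y > 0"
  shows "Lp p (poisson_U F y)" "Lp_norm p (poisson_U F y) \<le> Lp_norm p F"
proof -
  let ?A = "LINT x|lborel. \<bar>F x\<bar> powr p"
  have int: "integrable lborel (\<lambda>x. \<bar>F x\<bar> powr p)" using F by (simp add: Lp_def)
  have A: "?A \<ge> 0" by simp
  \<comment> \<open>By translation invariance the inner integral is constant in \<open>t\<close>,
    and averaging a constant against a kernel of mass one returns it.\<close>
  have "(\<integral>\<^sup>+ x. ennreal (\<bar>F (x - t)\<bar> powr p) \<partial>lborel) = ennreal ?A" for t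
    using integrable_translate[OF int, of t] integral_translate[of "\<lambda>x. \<bar>F x\<bar> powr p" t]
    by (simp add: nn_integral_eq_integral)
  then have "(\<integral>\<^sup>+ x. ennreal (\<bar>poisson_U F y x\<bar> powr p) \<partial>lborel)
      \<le> (\<integral>\<^sup>+ t. ennreal (poisson_kernel y t) * ennreal ?A \<partial>lborel)"
    using nn_integral_poisson_U_diff_le[OF assms, of 0] by simp
  also have "\<dots> = ennreal ?A"
    using nn_integral_poisson_kernel[OF y] by (simp add: nn_integral_multc)
  finally have le: "(\<integral>\<^sup>+ x. ennreal (\<bar>poisson_U F y x\<bar> powr p) \<partial>lborel) \<le> ennreal ?A" .
  have [measurable]: "poisson_U F y \<in> borel_measurable borel"
    by (rule poisson_U_measurable[OF assms])
  note * = integral_le_of_nn_integral_le[OF _ _ le A]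
  show "Lp p (poisson_U F y)" unfolding Lp_def by (simp add: *(1))
  show "Lp_norm p (poisson_U F y) \<le> Lp_norm p F"
    unfolding Lp_norm_def using p by (intro powr_mono2 *(2)) auto
qed

lemma Lp_diff:
  assumes "0 \<le> p" "Lp p f" "Lp p g"
  shows "Lp p (\<lambda>x. f x - g x)"
    and "(LINT x|lborel. \<bar>f x - g x\<bar> powr p)
      \<le> 2 powr p * ((LINT x|lborel. \<bar>f x\<bar> powr p) + (LINT x|lborel. \<bar>g x\<bar> powr p))"
proof -
  have [measurable]: "f \<in> borel_measurable borel" "g \<in> borel_measurable borel"
    and i: "integrable lborel (\<lambda>x. \<bar>f x\<bar> powr p)" "integrable lborel (\<lambda>x. \<bar>g x\<bar> powr p)"
    using assms by (auto simp: Lp_def)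
  have i': "integrable lborel (\<lambda>x. 2 powr p * (\<bar>f x\<bar> powr p + \<bar>g x\<bar> powr p))"
    using i by simp
  have le: "\<bar>f x - g x\<bar> powr p \<le> 2 powr p * (\<bar>f x\<bar> powr p + \<bar>g x\<bar> powr p)" for x
    using powr_add_le[OF assms(1), of "f x" "- g x"] by simp
  have d: "integrable lborel (\<lambda>x. \<bar>f x - g x\<bar> powr p)"
    by (rule Bochner_Integration.integrable_bound[OF i']) (use le in auto)
  then show "Lp p (\<lambda>x. f x - g x)" by (simp add: Lp_def)
  have "(LINT x|lborel. \<bar>f x - g x\<bar> powr p) \<le> (LINT x|lborel. 2 powr p * (\<bar>f x\<bar> powr p + \<bar>g x\<bar> powr p))"
    by (rule integral_mono[OF d i' le])
  then show "(LINT x|lborel. \<bar>f x - g x\<bar> powr p)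
      \<le> 2 powr p * ((LINT x|lborel. \<bar>f x\<bar> powr p) + (LINT x|lborel. \<bar>g x\<bar> powr p))"
    using i by simp
qed

lemma Lp_translate:
  assumes "Lp p f"
  shows "Lp p (\<lambda>x. f (x - t))"
proof -
  have [measurable]: "f \<in> borel_measurable borel" using assms by (simp add: Lp_def)
  show ?thesis
    using assms integrable_translate[of "\<lambda>x. \<bar>f x\<bar> powr p" t] by (simp add: Lp_def)
qed

subsection \<open>Continuity of translation and convergence\<close>

text \<open>The predicate \<open>measurable_on\<close> means being a limit of continuous functions
  off a negligible set; the exceptional set is then carried from Lebesgue to Borel measure.\<close>

lemma continuous_approximations_AE:
  fixes f :: "real \<Rightarrow> real"
  assumes "f \<in> borel_measurable borel"
  shows "\<exists>h. (\<forall>k::nat. continuous_on UNIV (h k)) \<and> (AE x in lborel. (\<lambda>k. h k x) \<longlonglongrightarrow> f x)"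
proof -
  have "f \<in> borel_measurable lebesgue"
    using assms by (simp add: measurable_completion)
  then have "f measurable_on UNIV"
    by (simp add: lebesgue_measurable_imp_measurable_on)
  then obtain N h where N: "negligible N" and h: "\<And>k. continuous_on UNIV (h k)"
    "\<And>x. x \<notin> N \<Longrightarrow> (\<lambda>k. h k x) \<longlonglongrightarrow> f x"
    unfolding measurable_on_def by auto
  have "AE x in lebesgue. x \<notin> N"
    using N by (intro AE_not_in) (simp add: negligible_iff_null_sets)
  then have "AE x in lborel. x \<notin> N" by (simp add: AE_completion_iff)
  then have "AE x in lborel. (\<lambda>k. h k x) \<longlonglongrightarrow> f x" using h(2) by auto
  with h(1) show ?thesis by blast
qed

text \<open>Values are clipped to \<open>[-N, N]\<close> and multiplied by a trapezoid that is 1 on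
  \<open>[-N, N]\<close> and 0 outside \<open>[-N - 1, N + 1]\<close>. Both factors are continuous,
  so the cutoff preserves continuity and pointwise limits, which an indicator in place of the
  trapezoid would not do for continuity.\<close>

definition cutoff :: "real \<Rightarrow> real \<Rightarrow> real \<Rightarrow> real" where
  "cutoff N v x = max (-N) (min N v) * max 0 (min 1 (N + 1 - \<bar>x\<bar>))"

lemma cutoff_measurable [measurable]:
  assumes "f \<in> borel_measurable borel"
  shows "(\<lambda>x. cutoff N (f x) x) \<in> borel_measurable borel"
proof -
  have *: "(\<lambda>x. max 0 (min 1 (N + 1 - \<bar>x\<bar>))) \<in> borel_measurable borel"
    by (intro borel_measurable_continuous_onI continuous_intros)
  show ?thesis
    unfolding cutoff_def using assms
    by (intro borel_measurable_times[OF _ *] borel_measurable_max borel_measurable_min borel_measurable_const)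
qed

lemma abs_cutoff_le:
  assumes "0 \<le> N"
  shows "\<bar>cutoff N v x\<bar> \<le> N * indicator {- N - 1..N + 1} x"
proof -
  have "\<bar>max (-N) (min N v)\<bar> \<le> N" "\<bar>max 0 (min 1 (N + 1 - \<bar>x\<bar>))\<bar> \<le> indicator {- N - 1..N + 1} x"
    using assms by (auto simp: indicator_def)
  then show ?thesis unfolding cutoff_def abs_mult by (intro mult_mono) (use assms in auto)
qed

text \<open>For \<open>N \<ge> 0\<close> the cutoff value lies between 0 and \<open>v\<close>. This
  makes \<open>\<bar>F x\<bar> powr p\<close> a dominating function for the truncation
  error.\<close>

lemma abs_diff_cutoff_le:
  assumes "0 \<le> N"
  shows "\<bar>v - cutoff N v x\<bar> \<le> \<bar>v\<bar>"
proof -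
  define m c where "m = max (-N) (min N v)" and "c = max 0 (min 1 (N + 1 - \<bar>x\<bar>))"
  have c: "0 \<le> c" "c \<le> 1" by (auto simp: c_def)
  have "0 \<le> m * c \<and> m * c \<le> v \<or> v \<le> m * c \<and> m * c \<le> 0"
  proof (cases "v \<ge> 0")
    case True
    then have "0 \<le> m" "m \<le> v" using assms by (auto simp: m_def)
    then show ?thesis using c mult_left_le[of c m] by auto
  next
    case False
    then have "m \<le> 0" "v \<le> m" using assms by (auto simp: m_def)
    then show ?thesis using c mult_left_le[of c "- m"] mult_nonpos_nonneg[of m c] by auto
  qed
  then show ?thesis unfolding cutoff_def m_def[symmetric] c_def[symmetric] by auto
qed

lemma cutoff_eventually: "eventually (\<lambda>k. cutoff (real k) v x = v) sequentially"
proof -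
  obtain K where K: "real K \<ge> max \<bar>v\<bar> \<bar>x\<bar>" using real_arch_simple by blast
  have "cutoff (real k) v x = v" if "k \<ge> K" for k
  proof -
    have "real k \<ge> real K" using that by simp
    then have "max (- real k) (min (real k) v) = v" "max 0 (min 1 (real k + 1 - \<bar>x\<bar>)) = 1" using K by auto
    then show ?thesis by (simp add: cutoff_def)
  qed
  then show ?thesis unfolding eventually_sequentially by blast
qed

lemma tendsto_abs_powr_zero:
  fixes f :: "nat \<Rightarrow> real"
  assumes "f \<longlonglongrightarrow> 0" "0 < p"
  shows "(\<lambda>k. \<bar>f k\<bar> powr p) \<longlonglongrightarrow> 0"
  by (rule tendsto_zero_powrI[OF tendsto_rabs_zero[OF assms(1)] tendsto_const]) (use assms in auto)

lemma integrable_indicator_Icc: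
  fixes a b c :: real
  shows "integrable lborel (\<lambda>x. c * indicator {a..b} x :: real)"
  by (intro integrable_mult_right integrable_real_indicator) (auto simp: emeasure_lborel_Icc_eq)

lemma Lp_bounded_support:
  assumes [measurable]: "f \<in> borel_measurable borel" and "\<And>x. \<bar>f x\<bar> \<le> B * indicator {a..b::real} x"
    and p: "0 < p"
  shows "Lp p f"
proof -
  have le: "\<bar>f x\<bar> powr p \<le> B powr p * indicator {a..b} x" for x
  proof (cases "x \<in> {a..b}")
    case True
    then show ?thesis using assms(2)[of x] p by (auto intro!: powr_mono2)
  next
    case False
    then show ?thesis using assms(2)[of x] p by auto
  qed
  have "integrable lborel (\<lambda>x. \<bar>f x\<bar> powr p)"
  proof (rule Bochner_Integration.integrable_bound[OF integrable_indicator_Icc])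
    show "AE x in lborel. norm (\<bar>f x\<bar> powr p) \<le> norm (B powr p * indicator {a..b} x :: real)"
      using le by (simp add: abs_mult)
  qed simp
  then show ?thesis by (simp add: Lp_def)
qed

text \<open>Two dominated limits in succession: first \<open>F\<close> is replaced by its cutoff at
  a high level, then, with the level fixed, \<open>F\<close> inside the cutoff is replaced by a
  continuous \<open>h k\<close>. In the second limit everything lives on one bounded
  interval.\<close>

lemma Lp_approx_continuous:
  assumes p: "0 < p" and F: "Lp p F" and e: "e > 0"
  shows "\<exists>g N. continuous_on UNIV g \<and> 0 \<le> N \<and> (\<forall>x. \<bar>g x\<bar> \<le> N * indicator {- N - 1..N + 1} x) \<and>
    (LINT x|lborel. \<bar>F x - g x\<bar> powr p) < e"
proof -
  have [measurable]: "F \<in> borel_measurable borel" and int: "integrable lborel (\<lambda>x. \<bar>F x\<bar> powr p)"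
    using F by (auto simp: Lp_def)
  \<comment> \<open>Chosen so that \<open>2 powr p * (e' + e') = e\<close> when the two errors are
    added.\<close>
  define e' where "e' = e / (2 * 2 powr p)"
  have e': "e' > 0" using e by (simp add: e'_def)
  have "(\<lambda>k. LINT x|lborel. \<bar>F x - cutoff (real k) (F x) x\<bar> powr p) \<longlonglongrightarrow> (LINT x|(lborel::real measure). 0::real)"
  proof (rule integral_dominated_convergence[OF _ _ int])
    show "AE x in lborel. (\<lambda>k. \<bar>F x - cutoff (real k) (F x) x\<bar> powr p) \<longlonglongrightarrow> 0"
    proof (rule AE_I2)
      fix x
      have "(\<lambda>k. F x - cutoff (real k) (F x) x) \<longlonglongrightarrow> 0"
        by (rule tendsto_eventually) (use cutoff_eventually[of "F x" x] in \<open>auto elim: eventually_mono\<close>)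
      then show "(\<lambda>k. \<bar>F x - cutoff (real k) (F x) x\<bar> powr p) \<longlonglongrightarrow> 0"
        by (rule tendsto_abs_powr_zero) (rule p)
    qed
    show "AE x in lborel. norm (\<bar>F x - cutoff (real k) (F x) x\<bar> powr p) \<le> \<bar>F x\<bar> powr p" for k
      using p by (auto intro!: powr_mono2 abs_diff_cutoff_le)
  qed simp_all
  then have "eventually (\<lambda>k. (LINT x|lborel. \<bar>F x - cutoff (real k) (F x) x\<bar> powr p) < e') sequentially"
    by (intro order_tendstoD(2)[OF _ e']) simp
  then obtain K where K: "(LINT x|lborel. \<bar>F x - cutoff (real K) (F x) x\<bar> powr p) < e'"
    by (auto simp: eventually_sequentially)
  define N where "N = real K"
  have N: "N \<ge> 0" by (simp add: N_def)
  obtain h :: "nat \<Rightarrow> real \<Rightarrow> real" where h: "\<And>k. continuous_on UNIV (h k)" "AE x in lborel. (\<lambda>k. h k x) \<longlonglongrightarrow> F x"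
    using continuous_approximations_AE[of F] by auto
  have [measurable]: "h k \<in> borel_measurable borel" for k
    using h(1) by (rule borel_measurable_continuous_onI)
  have "(\<lambda>k. LINT x|lborel. \<bar>cutoff N (h k x) x - cutoff N (F x) x\<bar> powr p) \<longlonglongrightarrow> (LINT x|(lborel::real measure). 0::real)"
  proof (rule integral_dominated_convergence)
    show "integrable lborel (\<lambda>x. (2 * N) powr p * indicator {- N - 1..N + 1} x :: real)"
      by (rule integrable_indicator_Icc)
    show "AE x in lborel. (\<lambda>k. \<bar>cutoff N (h k x) x - cutoff N (F x) x\<bar> powr p) \<longlonglongrightarrow> 0"
      using h(2)
    proof eventually_elim
      case (elim x)
      then have "(\<lambda>k. cutoff N (h k x) x - cutoff N (F x) x) \<longlonglongrightarrow> cutoff N (F x) x - cutoff N (F x) x"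
        unfolding cutoff_def by (intro tendsto_intros tendsto_max tendsto_min)
      then show ?case by (intro tendsto_abs_powr_zero p) simp
    qed
    show "AE x in lborel. norm (\<bar>cutoff N (h k x) x - cutoff N (F x) x\<bar> powr p)
        \<le> (2 * N) powr p * indicator {- N - 1..N + 1} x" for k
    proof (rule AE_I2)
      fix x
      have "\<bar>cutoff N (h k x) x - cutoff N (F x) x\<bar> \<le> 2 * N * indicator {- N - 1..N + 1} x"
        using abs_cutoff_le[OF N, of "h k x" x] abs_cutoff_le[OF N, of "F x" x] by linarith
      then show "norm (\<bar>cutoff N (h k x) x - cutoff N (F x) x\<bar> powr p)
        \<le> (2 * N) powr p * indicator {- N - 1..N + 1} x"
        using p by (auto simp: indicator_def split: if_splits intro!: powr_mono2)
    qed
  qed simp_all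
  then have "eventually (\<lambda>k. (LINT x|lborel. \<bar>cutoff N (h k x) x - cutoff N (F x) x\<bar> powr p) < e') sequentially"
    by (intro order_tendstoD(2)[OF _ e']) simp
  then obtain k where k: "(LINT x|lborel. \<bar>cutoff N (h k x) x - cutoff N (F x) x\<bar> powr p) < e'"
    by (auto simp: eventually_sequentially)
  define g where "g x = cutoff N (h k x) x" for x
  have gc: "continuous_on UNIV g"
    unfolding g_def cutoff_def by (intro continuous_intros h)
  have cut: "Lp p (\<lambda>x. cutoff N (F x) x)" "Lp p g"
    unfolding g_def by (rule Lp_bounded_support[OF _ abs_cutoff_le[OF N] p]; measurable)+
  have "(LINT x|lborel. \<bar>(F x - cutoff N (F x) x) - (g x - cutoff N (F x) x)\<bar> powr p) \<le>
      2 powr p * ((LINT x|lborel. \<bar>F x - cutoff N (F x) x\<bar> powr p) + (LINT x|lborel. \<bar>g x - cutoff N (F x) x\<bar> powr p))"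
    using p by (intro Lp_diff F cut) auto
  also have "\<dots> < 2 powr p * (e' + e')"
    using K k unfolding g_def N_def by (intro mult_strict_left_mono add_strict_mono) auto
  also have "\<dots> = e" by (simp add: e'_def)
  finally have "(LINT x|lborel. \<bar>F x - g x\<bar> powr p) < e" by simp
  with gc N abs_cutoff_le[OF N] show ?thesis unfolding g_def by blast
qed

text \<open>For shifts of size below 1 all translates live on \<open>[-N - 2, N + 2]\<close>, so
  continuity of \<open>g\<close> and dominated convergence suffice.\<close>

lemma continuous_translation_Lp:
  fixes g :: "real \<Rightarrow> real"
  assumes p: "0 < p" and g: "continuous_on UNIV g" and N: "0 \<le> N"
    and bd: "\<And>x. \<bar>g x\<bar> \<le> N * indicator {- N - 1..N + 1} x"
  shows "((\<lambda>t. LINT x|lborel. \<bar>g (x - t) - g x\<bar> powr p) \<longlongrightarrow> 0) (at 0 within ball 0 1)"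
  unfolding tendsto_at_iff_sequentially
proof (intro allI impI)
  fix X :: "nat \<Rightarrow> real"
  assume X: "\<forall>i. X i \<in> ball 0 1 - {0}" "X \<longlonglongrightarrow> 0"
  have [measurable]: "g \<in> borel_measurable borel"
    using g by (rule borel_measurable_continuous_onI)
  have "(\<lambda>i. LINT x|lborel. \<bar>g (x - X i) - g x\<bar> powr p) \<longlonglongrightarrow> (LINT x|(lborel::real measure). 0::real)"
  proof (rule integral_dominated_convergence)
    show "integrable lborel (\<lambda>x. (2 * N) powr p * indicator {- N - 2..N + 2} x :: real)"
      by (rule integrable_indicator_Icc)
    show "AE x in lborel. (\<lambda>i. \<bar>g (x - X i) - g x\<bar> powr p) \<longlonglongrightarrow> 0"
    proof (rule AE_I2)
      fix x
      have "(\<lambda>i. x - X i) \<longlonglongrightarrow> x - 0" by (intro tendsto_intros X)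
      then have "(\<lambda>i. g (x - X i)) \<longlonglongrightarrow> g x"
        using g by (auto intro!: continuous_on_tendsto_compose[OF g])
      then have "(\<lambda>i. g (x - X i) - g x) \<longlonglongrightarrow> 0" by (simp add: LIM_zero)
      then show "(\<lambda>i. \<bar>g (x - X i) - g x\<bar> powr p) \<longlonglongrightarrow> 0"
        by (rule tendsto_abs_powr_zero) (rule p)
    qed
    show "AE x in lborel. norm (\<bar>g (x - X i) - g x\<bar> powr p) \<le> (2 * N) powr p * indicator {- N - 2..N + 2} x" for i
    proof (rule AE_I2)
      fix x
      have X1: "\<bar>X i\<bar> < 1" using X(1) by (auto simp: dist_norm)
      have "\<bar>g (x - X i)\<bar> \<le> N * indicator {- N - 2..N + 2} x" "\<bar>g x\<bar> \<le> N * indicator {- N - 2..N + 2} x"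
        using bd[of "x - X i"] bd[of x] X1 N by (auto simp: indicator_def of_bool_def split: if_splits)
      then have "\<bar>g (x - X i) - g x\<bar> \<le> 2 * N * indicator {- N - 2..N + 2} x" by linarith
      then show "norm (\<bar>g (x - X i) - g x\<bar> powr p) \<le> (2 * N) powr p * indicator {- N - 2..N + 2} x"
        using p by (auto simp: indicator_def split: if_splits intro!: powr_mono2)
    qed
  qed simp_all
  then show "((\<lambda>t. LINT x|lborel. \<bar>g (x - t) - g x\<bar> powr p) \<circ> X) \<longlonglongrightarrow> 0"
    by (simp add: comp_def)
qed

text \<open>Approximate \<open>F\<close> by a compactly supported continuous \<open>g\<close>; the
  error \<open>F - g\<close> contributes equally before and after the shift, by translation
  invariance.\<close>

lemma Lp_translation_continuous:
  assumes p: "0 < p" and F: "Lp p F" and e: "e > 0"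
  shows "\<exists>d>0. \<forall>t. \<bar>t\<bar> < d \<longrightarrow> (LINT x|lborel. \<bar>F (x - t) - F x\<bar> powr p) < e"
proof -
  define C where "C = (2::real) powr p"
  have C: "C > 0" by (simp add: C_def)
  \<comment> \<open>Splitting off the shift of \<open>g\<close> costs one factor \<open>C\<close>,
    and separating the two errors in \<open>F - g\<close> costs another, giving the total
    \<open>C * (C * (e' + e') + e')\<close>.\<close>
  define e' where "e' = e / (C + 2 * C * C)"
  have C2: "C + 2 * C * C > 0" using C by (simp add: add_pos_pos)
  have e': "e' > 0" using e C2 by (simp add: e'_def)
  obtain g N where g: "continuous_on UNIV g" and N: "0 \<le> N"
    and bd: "\<And>x. \<bar>g x\<bar> \<le> N * indicator {- N - 1..N + 1} x"
    and Fg: "(LINT x|lborel. \<bar>F x - g x\<bar> powr p) < e'"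
    using Lp_approx_continuous[OF p F e'] by blast
  have [measurable]: "g \<in> borel_measurable borel"
    using g by (rule borel_measurable_continuous_onI)
  have gL: "Lp p g" by (rule Lp_bounded_support[OF _ bd p]) measurable
  have "((\<lambda>t. LINT x|lborel. \<bar>g (x - t) - g x\<bar> powr p) \<longlongrightarrow> 0) (at 0)"
    using continuous_translation_Lp[OF p g N bd] at_within_open[of "0::real" "ball 0 1"] by simp
  then have "eventually (\<lambda>t. (LINT x|lborel. \<bar>g (x - t) - g x\<bar> powr p) < e') (at 0)"
    by (intro order_tendstoD(2)[OF _ e']) simp
  then obtain d where d: "d > 0" "\<And>t. t \<noteq> 0 \<Longrightarrow> \<bar>t\<bar> < d \<Longrightarrow> (LINT x|lborel. \<bar>g (x - t) - g x\<bar> powr p) < e'"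
    by (auto simp: eventually_at dist_norm)
  have "(LINT x|lborel. \<bar>F (x - t) - F x\<bar> powr p) < e" if t: "\<bar>t\<bar> < d" for t
  proof -
    let ?a = "\<lambda>x. F x - g x"
    have a: "Lp p ?a"
      using p by (intro Lp_diff(1) F gL) simp
    have at: "Lp p (\<lambda>x. ?a (x - t))" by (rule Lp_translate[OF a])
    have b: "Lp p (\<lambda>x. g x - g (x - t))"
      using p by (intro Lp_diff(1) gL Lp_translate[OF gL]) simp
    \<comment> \<open>The limit at 0 says nothing about \<open>t = 0\<close>, where the integral is
      zero anyway.\<close>
    have gt: "(LINT x|lborel. \<bar>g x - g (x - t)\<bar> powr p) < e'"
      using d(2)[OF _ t] e' by (cases "t = 0") (auto simp: abs_minus_commute)
    have "(LINT x|lborel. \<bar>F (x - t) - F x\<bar> powr p)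
        = (LINT x|lborel. \<bar>(?a (x - t) - ?a x) - (g x - g (x - t))\<bar> powr p)"
      by (simp add: algebra_simps)
    also have "\<dots> \<le> C * ((LINT x|lborel. \<bar>?a (x - t) - ?a x\<bar> powr p) + (LINT x|lborel. \<bar>g x - g (x - t)\<bar> powr p))"
      unfolding C_def using p by (intro Lp_diff(2)[OF _ Lp_diff(1)[OF _ at a] b]) auto
    also have "\<dots> \<le> C * (C * ((LINT x|lborel. \<bar>?a (x - t)\<bar> powr p) + (LINT x|lborel. \<bar>?a x\<bar> powr p))
        + (LINT x|lborel. \<bar>g x - g (x - t)\<bar> powr p))"
      unfolding C_def using p by (intro mult_left_mono add_right_mono Lp_diff(2)[OF _ at a]) auto
    also have "(LINT x|lborel. \<bar>?a (x - t)\<bar> powr p) = (LINT x|lborel. \<bar>?a x\<bar> powr p)"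
      by (rule integral_translate[of "\<lambda>x. \<bar>?a x\<bar> powr p"])
    also have "C * (C * ((LINT x|lborel. \<bar>?a x\<bar> powr p) + (LINT x|lborel. \<bar>?a x\<bar> powr p))
        + (LINT x|lborel. \<bar>g x - g (x - t)\<bar> powr p)) < C * (C * (e' + e') + e')"
      using C Fg gt by (intro mult_strict_left_mono add_strict_mono) auto
    also have "\<dots> = e' * (C + 2 * C * C)" by (simp add: algebra_simps)
    also have "\<dots> = e" using C2 by (simp add: e'_def)
    finally show ?thesis .
  qed
  with d(1) show ?thesis by blast
qed

section \<open>Norm convergence of the Poisson integral at the boundary\<close>

text \<open>Away from the origin \<open>t^2 + 1\<close> is at most
  \<open>(1 + 1 / d^2) * t^2\<close>. Comparison with the kernel at height 1 makes the tail mass of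
  order \<open>y\<close> with no need to integrate the tail itself.\<close>

lemma poisson_kernel_tail:
  assumes "y > 0" "d > 0" "d \<le> \<bar>t\<bar>"
  shows "poisson_kernel y t \<le> y * (1 + 1 / d\<^sup>2) * poisson_kernel 1 t"
proof -
  have t: "d\<^sup>2 \<le> t\<^sup>2" using assms by (metis abs_of_pos power2_abs power_mono less_imp_le)
  have t0: "t\<^sup>2 > 0" using assms by auto
  have "t\<^sup>2 + 1 \<le> (1 + 1 / d\<^sup>2) * t\<^sup>2"
    using t assms by (simp add: field_simps)
  also have "\<dots> \<le> (1 + 1 / d\<^sup>2) * (t\<^sup>2 + y\<^sup>2)"
    by (intro mult_left_mono) auto
  finally have "1 / (t\<^sup>2 + y\<^sup>2) \<le> (1 + 1 / d\<^sup>2) / (t\<^sup>2 + 1)"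
    using t0 by (simp add: divide_simps add_pos_nonneg mult.commute)
  then have "y / pi * (1 / (t\<^sup>2 + y\<^sup>2)) \<le> y / pi * ((1 + 1 / d\<^sup>2) / (t\<^sup>2 + 1))"
    using assms by (intro mult_left_mono) auto
  then show ?thesis by (simp add: poisson_kernel_def mult_ac)
qed

text \<open>The error is at most the kernel average of the translation modulus \<open>w\<close>.
  Near 0 the modulus is small by continuity of translation; elsewhere it is bounded by
  \<open>B\<close> and meets a tail of order \<open>y\<close>.\<close>

lemma poisson_U_converges:
  assumes p: "1 \<le> p" and F: "Lp p F"
  shows "((\<lambda>y. Lp_norm p (\<lambda>x. poisson_U F y x - F x)) \<longlongrightarrow> 0) (at_right 0)"
proof -
  have p0: "0 < p" using p by simp
  have [measurable]: "F \<in> borel_measurable borel" using F by (simp add: Lp_def)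
  define w where "w t = (LINT x|lborel. \<bar>F (x - t) - F x\<bar> powr p)" for t
  define B where "B = 2 powr p * (2 * (LINT x|lborel. \<bar>F x\<bar> powr p))"
  have w0: "0 \<le> w t" for t by (simp add: w_def)
  have B0: "0 \<le> B" by (simp add: B_def)
  have wB: "w t \<le> B" for t
    using Lp_diff(2)[OF _ Lp_translate[OF F, of t] F] p integral_translate[of "\<lambda>x. \<bar>F x\<bar> powr p" t]
    by (simp add: w_def B_def)
  have nn_w: "(\<integral>\<^sup>+ x. ennreal (\<bar>F (x - t) - F x\<bar> powr p) \<partial>lborel) = ennreal (w t)" for t
    using Lp_diff(1)[OF _ Lp_translate[OF F, of t] F] p unfolding w_def
    by (intro nn_integral_eq_integral) (auto simp: Lp_def)
  have bound: "(LINT x|lborel. \<bar>poisson_U F y x - F x\<bar> powr p) \<le> e + B * (y * (1 + 1 / d\<^sup>2))"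
    if y: "y > 0" and e: "e > 0" and d: "d > 0" and wd: "\<And>t. \<bar>t\<bar> < d \<Longrightarrow> w t < e" for y e d
  proof -
    have [measurable]: "poisson_U F y \<in> borel_measurable borel"
      by (rule poisson_U_measurable[OF p F y])
    let ?D = "B * (y * (1 + 1 / d\<^sup>2))"
    have D: "?D \<ge> 0" using B0 y by simp
    note P = poisson_kernel_nonneg[OF y] poisson_kernel_nonneg[of 1, simplified]
    \<comment> \<open>One pointwise bound covers both ranges of \<open>t\<close>: the near case uses
      the first summand, the far case the second. Both kernels have mass one, so integration leaves
      \<open>e + ?D\<close>.\<close>
    have pw: "poisson_kernel y t * w t \<le> e * poisson_kernel y t + ?D * poisson_kernel 1 t" for t
    proof (cases "\<bar>t\<bar> < d")
      case True
      then have "poisson_kernel y t * w t \<le> poisson_kernel y t * e"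
        using P wd[of t] by (intro mult_left_mono) auto
      moreover have "0 \<le> ?D * poisson_kernel 1 t" by (rule mult_nonneg_nonneg[OF D P(2)])
      ultimately show ?thesis by (simp add: mult.commute)
    next
      case False
      then have "poisson_kernel y t * w t \<le> (y * (1 + 1 / d\<^sup>2) * poisson_kernel 1 t) * B"
        using poisson_kernel_tail[OF y d, of t] wB[of t] w0[of t] y P
        by (intro mult_mono) auto
      moreover have "0 \<le> e * poisson_kernel y t" using e P by auto
      ultimately show ?thesis by (simp add: mult_ac)
    qed
    have "(\<integral>\<^sup>+ x. ennreal (\<bar>poisson_U F y x - F x\<bar> powr p) \<partial>lborel)
        \<le> (\<integral>\<^sup>+ t. ennreal (poisson_kernel y t) * ennreal (w t) \<partial>lborel)"
      using nn_integral_poisson_U_diff_le[OF p F y, of 1] by (simp add: nn_w)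
    also have "\<dots> \<le> (\<integral>\<^sup>+ t. ennreal e * ennreal (poisson_kernel y t) + ennreal ?D * ennreal (poisson_kernel 1 t) \<partial>lborel)"
    proof (rule nn_integral_mono)
      fix t
      have "ennreal (poisson_kernel y t) * ennreal (w t) = ennreal (poisson_kernel y t * w t)"
        using P w0 by (simp add: ennreal_mult)
      also have "\<dots> \<le> ennreal (e * poisson_kernel y t + ?D * poisson_kernel 1 t)"
        by (rule ennreal_leI[OF pw])
      also have "\<dots> = ennreal e * ennreal (poisson_kernel y t) + ennreal ?D * ennreal (poisson_kernel 1 t)"
        using e D P by (simp add: ennreal_plus ennreal_mult del: ennreal_plus[symmetric])
      finally show "ennreal (poisson_kernel y t) * ennreal (w t) \<le>
          ennreal e * ennreal (poisson_kernel y t) + ennreal ?D * ennreal (poisson_kernel 1 t)" .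
    qed
    also have "\<dots> = ennreal e * 1 + ennreal ?D * 1"
      using y by (simp add: nn_integral_add nn_integral_cmult nn_integral_poisson_kernel)
    also have "\<dots> = ennreal (e + ?D)"
      using e D by (simp add: ennreal_plus)
    finally show ?thesis
      using e D by (intro integral_le_of_nn_integral_le(2)) auto
  qed
  have "((\<lambda>y. LINT x|lborel. \<bar>poisson_U F y x - F x\<bar> powr p) \<longlongrightarrow> 0) (at_right 0)"
  proof (rule tendstoI)
    fix e :: real assume e: "e > 0"
    then obtain d where d: "d > 0" "\<And>t. \<bar>t\<bar> < d \<Longrightarrow> w t < e / 2"
      using Lp_translation_continuous[OF p0 F, of "e / 2"] unfolding w_def by auto
    \<comment> \<open>The radius \<open>d\<close> is fixed before \<open>y\<close> tends to 0, so
      the second summand vanishes in the limit.\<close>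
    have "((\<lambda>y. e / 2 + B * (y * (1 + 1 / d\<^sup>2))) \<longlongrightarrow> e / 2 + B * (0 * (1 + 1 / d\<^sup>2))) (at_right 0)"
      by (intro tendsto_intros)
    then have "eventually (\<lambda>y. e / 2 + B * (y * (1 + 1 / d\<^sup>2)) < e) (at_right 0)"
      by (rule order_tendstoD(2)) (use e in simp)
    moreover have "eventually (\<lambda>y::real. y > 0) (at_right 0)"
      by (rule eventually_at_right_less)
    ultimately show "eventually (\<lambda>y. dist (LINT x|lborel. \<bar>poisson_U F y x - F x\<bar> powr p) 0 < e) (at_right 0)"
    proof eventually_elim
      case (elim y)
      have "(LINT x|lborel. \<bar>poisson_U F y x - F x\<bar> powr p) < e"
        using bound[OF elim(2) _ d(1,2)] e elim(1) by fastforce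
      then show ?case by (simp add: dist_norm)
    qed
  qed
  then show ?thesis
    unfolding Lp_norm_def using p by (intro tendsto_zero_powrI[OF _ tendsto_const]) auto
qed

theorem mainTheorem18:
  fixes p :: real and n :: nat and F :: "real \<Rightarrow> real"
  assumes "1 \<le> p" and "Lp p F"
  shows "(\<forall>x y. y > 0 \<longrightarrow>
            integrable lborel
              (\<lambda>\<xi>. F \<xi> * (deriv ^^ n) (\<lambda>\<eta>. poisson_kernel y (\<eta> - x)) \<xi>) \<and>
            has_nth_derivs n (poisson_U F y) \<and>
            poisson_u n F y x = (deriv ^^ n) (poisson_U F y) x)
       \<and> harmonic_on {z. snd z > 0} (\<lambda>(x, y). poisson_u n F y x)
       \<and> (\<forall>y. y > 0 \<longrightarrow>
            Lp p (poisson_U F y) \<and>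
            is_nth_distr_deriv n (poisson_U F y) (poisson_u n F y) \<and>
            Lp_norm p (poisson_U F y) \<le> Lp_norm p F)
       \<and> ((\<lambda>y. Lp_norm p (\<lambda>x. poisson_U F y x - F x)) \<longlongrightarrow> 0) (at_right 0)"
proof -
  \<comment> \<open>The derivative formula, harmonicity and the distributional identity come from
    the locale; the two norm statements concern the primitives and use the estimates for
    \<open>p\<close>.\<close>
  interpret cauchy_integrable F by (rule Lp_cauchy_integrable[OF assms])
  show ?thesis
    using poisson_u_integrable has_nth_derivs_poisson_U poisson_u_eq iterated_deriv_poisson_U
      harmonic_poisson_u poisson_U_Lp[OF assms] poisson_u_distr_deriv poisson_U_converges[OF assms]
    by simp
qed

end
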